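(* Let $G$ be a finite simple graph. Then the following hold: (a) For any $v\in V(G)$, $\mathrm{v}(J_G)\le \mathrm{v}(J_{G_v})+1$. (b) For a vertex $v$ of $G$, if there exists a cutset $T$ of $G$ such that $v\notin T$ and $\mathrm{v}(J_G)=\mathrm{v}_T(J_G)$, then $\mathrm{v}(J_{G_v})\le \mathrm{v}(J_G)$. (c) For a vertex $v$ of $G$, if there exists a cutset $T$ of $G$ such that $v\in T$ and $\mathrm{v}(J_G)=\mathrm{v}_T(J_G)$, then $\mathrm{v}(J_{G\setminus\{v\}})\le \mathrm{v}(J_G)$.
   Context: Let $K$ be a field. For a finite simple graph $G$ with (totally ordered) vertex set $V(G)$, put $S=K[x_i,y_i\mid i\in V(G)]$ (standard grading), $f_{ij}=x_iy_j-x_jy_i$, and $J_G=\langle f_{ij}\mid\{i,j\}\in E(G), i<j\rangle$ (binomial edge ideal). For $v\in V(G)$ with neighbour set $\mathcal N_G(v)$, $G_v$ is the graph with $V(G_v)=V(G)$ and $E(G_v)=E(G)\cup\{\{i,j\}\mid i,j\in\mathcal N_G(v), i\ne j\}$. $G\setminus T$ is the induced subgraph on $V(G)\setminus T$. A vertex is a cut vertex of a graph if its removal increases the number of connected components. $T\subseteq V(G)$ is a cutset of $G$ if each $t\in T$ is a cut vertex of $G\setminus(T\setminus\{t\})$ (so $\emptyset$ is a cutset). For a cutset $T$, $P_T(G)=\langle x_i,y_i\mid i\in T\rangle+\langle f_{ij}\mid i<j\text{ in the same connected component of }G\setminus T\rangle$; the ideal $J_G$ is radical and its associated primes are exactly the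 $P_T(G)$, $T$ a cutset of $G$. For a proper graded ideal $I$ of a standard graded polynomial ring $R=\bigoplus_d R_d$ and $\mathfrak p\in\mathrm{Ass}(I)$ (associated primes of $R/I$), $\mathrm{v}_{\mathfrak p}(I)=\min\{d\ge 0\mid \exists f\in R_d \text{ with } (I:f)=\mathfrak p\}$ and $\mathrm{v}(I)=\min\{\mathrm{v}_{\mathfrak p}(I)\mid \mathfrak p\in \mathrm{Ass}(I)\}$. Write $\mathrm{v}_T(J_G)=\mathrm{v}_{P_T(G)}(J_G)$. *)

theory Defs
  imports "HOL-Algebra.Ideal" "HOL-Library.Poly_Mapping" "HOL-Library.Extended_Nat"
begin

section \<open>Finite simple graphs\<close>

record 'v ugraph =
  verts :: "'v set"
  edges :: "'v set set"

definition simple_graph :: "'v ugraph \<Rightarrow> bool" where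
  "simple_graph G \<longleftrightarrow>
     finite (verts G) \<and> (\<forall>e \<in> edges G. \<exists>i \<in> verts G. \<exists>j \<in> verts G. i \<noteq> j \<and> e = {i, j})"

definition nbrs :: "'v ugraph \<Rightarrow> 'v \<Rightarrow> 'v set" where
  "nbrs G v = {w. {v, w} \<in> edges G}"

definition complete_nbrs :: "'v ugraph \<Rightarrow> 'v \<Rightarrow> 'v ugraph" where
  "complete_nbrs G v =
     \<lparr>verts = verts G,
      edges = edges G \<union> {{i, j} | i j. i \<in> nbrs G v \<and> j \<in> nbrs G v \<and> i \<noteq> j}\<rparr>"

definition del_verts :: "'v ugraph \<Rightarrow> 'v set \<Rightarrow> 'v ugraph" where
  "del_verts G T = \<lparr>verts = verts G - T, edges = {e \<in> edges G. e \<inter> T = {}}\<rparr>"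

definition same_component :: "'v ugraph \<Rightarrow> ('v \<times> 'v) set" where
  "same_component G =
     {(i, j). i \<in> verts G \<and> j \<in> verts G \<and> (i, j) \<in> {(a, b). {a, b} \<in> edges G}\<^sup>*}"

definition components :: "'v ugraph \<Rightarrow> 'v set set" where
  "components G = verts G // same_component G"

definition cut_vertex :: "'v ugraph \<Rightarrow> 'v \<Rightarrow> bool" where
  "cut_vertex G v \<longleftrightarrow>
     v \<in> verts G \<and> card (components (del_verts G {v})) > card (components G)"

definition cutset :: "'v ugraph \<Rightarrow> 'v set \<Rightarrow> bool" where
  "cutset G T \<longleftrightarrow> T \<subseteq> verts G \<and> (\<forall>t \<in> T. cut_vertex (del_verts G (T - {t})) t)"


section \<open>Polynomial rings and their grading\<close>

text \<open>A monomial is a finitely supported exponent vector, a polynomial a finitely supported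
  family of coefficients; the ring structure on these types is the convolution product of
  \<^theory>\<open>HOL-Library.Poly_Mapping\<close>. Since \<open>G\<close> and \<open>G \<setminus> {v}\<close> have different polynomial rings, the
  set of variables is a parameter of the carrier.\<close>

type_synonym ('x, 'k) mpoly = "('x \<Rightarrow>\<^sub>0 nat) \<Rightarrow>\<^sub>0 'k"

definition mpoly_ring :: "'x set \<Rightarrow> ('x, 'k::field) mpoly ring" where
  "mpoly_ring X =
     \<lparr>carrier = {p. \<forall>m \<in> Poly_Mapping.keys p. Poly_Mapping.keys m \<subseteq> X},
      mult = (*), one = 1, zero = 0, add = (+)\<rparr>"

definition mvar :: "'x \<Rightarrow> ('x, 'k::field) mpoly" where
  "mvar a = Poly_Mapping.single (Poly_Mapping.single a 1) 1"

definition homog :: "'x set \<Rightarrow> nat \<Rightarrow> ('x, 'k::field) mpoly set" where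
  "homog X d =
     {p \<in> carrier (mpoly_ring X).
        \<forall>m \<in> Poly_Mapping.keys p. (\<Sum>a \<in> Poly_Mapping.keys m. Poly_Mapping.lookup m a) = d}"

lemma mpoly_ring_simps:
  "p \<in> carrier (mpoly_ring X) \<longleftrightarrow>
     (\<forall>m \<in> Poly_Mapping.keys p. Poly_Mapping.keys m \<subseteq> X)"
  "p \<otimes>\<^bsub>mpoly_ring X\<^esub> q = p * q" "\<one>\<^bsub>mpoly_ring X\<^esub> = 1"
  "p \<oplus>\<^bsub>mpoly_ring X\<^esub> q = p + q" "\<zero>\<^bsub>mpoly_ring X\<^esub> = 0"
  by (simp_all add: mpoly_ring_def)

lemma mpoly_ring_add_closed:
  assumes "p \<in> carrier (mpoly_ring X)" "q \<in> carrier (mpoly_ring X)"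
  shows "p + q \<in> carrier (mpoly_ring X)"
  using assms Poly_Mapping.keys_add[of p q] unfolding mpoly_ring_simps by blast

lemma mpoly_ring_mult_closed:
  assumes "p \<in> carrier (mpoly_ring X)" "q \<in> carrier (mpoly_ring X)"
  shows "p * q \<in> carrier (mpoly_ring X)"
  unfolding mpoly_ring_simps
proof
  fix m assume "m \<in> Poly_Mapping.keys (p * q)"
  then obtain a b where m: "m = a + b" and
      ab: "a \<in> Poly_Mapping.keys p" "b \<in> Poly_Mapping.keys q"
    using keys_mult[of p q] by blast
  have "Poly_Mapping.keys a \<subseteq> X" "Poly_Mapping.keys b \<subseteq> X"
    using assms ab unfolding mpoly_ring_simps by blast+
  then show "Poly_Mapping.keys m \<subseteq> X"
    using Poly_Mapping.keys_add[of a b] unfolding m by (meson Un_least subset_trans)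
qed

lemma mpoly_ring_cring: "cring (mpoly_ring X :: ('x, 'k::field) mpoly ring)"
proof (rule cringI)
  let ?R = "mpoly_ring X :: ('x, 'k) mpoly ring"
  show "abelian_group ?R"
  proof (rule abelian_groupI)
    fix p assume "p \<in> carrier ?R"
    then have "- p \<in> carrier ?R" by (simp add: mpoly_ring_simps)
    moreover have "- p \<oplus>\<^bsub>?R\<^esub> p = \<zero>\<^bsub>?R\<^esub>" by (simp add: mpoly_ring_simps)
    ultimately show "\<exists>q \<in> carrier ?R. q \<oplus>\<^bsub>?R\<^esub> p = \<zero>\<^bsub>?R\<^esub>" by blast
  next
    fix p q assume "p \<in> carrier ?R" "q \<in> carrier ?R"
    then show "p \<oplus>\<^bsub>?R\<^esub> q \<in> carrier ?R"
      unfolding mpoly_ring_simps(4) by (rule mpoly_ring_add_closed)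
  qed (simp_all add: mpoly_ring_simps ac_simps)
  show "comm_monoid ?R"
  proof (rule comm_monoidI)
    fix p q assume "p \<in> carrier ?R" "q \<in> carrier ?R"
    then show "p \<otimes>\<^bsub>?R\<^esub> q \<in> carrier ?R"
      unfolding mpoly_ring_simps(2) by (rule mpoly_ring_mult_closed)
  qed (simp_all add: mpoly_ring_simps ac_simps)
qed (simp add: mpoly_ring_simps distrib_right)


section \<open>Associated primes and v-numbers\<close>

definition colon :: "('a, 'm) ring_scheme \<Rightarrow> 'a set \<Rightarrow> 'a \<Rightarrow> 'a set" where
  "colon R I f = {g \<in> carrier R. g \<otimes>\<^bsub>R\<^esub> f \<in> I}"

text \<open>The annihilator in \<open>R\<close> of the class of \<open>f\<close> in \<open>R/I\<close> is \<open>(I : f)\<close>.\<close>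

definition Ass :: "('a, 'm) ring_scheme \<Rightarrow> 'a set \<Rightarrow> 'a set set" where
  "Ass R I = {P. primeideal P R \<and> (\<exists>f \<in> carrier R. P = colon R I f)}"

text \<open>The minima are taken in \<^typ>\<open>enat\<close>, so that a minimum over the empty set would be \<open>\<infinity>\<close>
  rather than some arbitrary number. For a proper graded ideal \<open>I\<close> and an associated prime \<open>P\<close>
  both sets are nonempty, and the infimum is then attained.\<close>

definition v_at :: "'x set \<Rightarrow> ('x, 'k::field) mpoly set \<Rightarrow> ('x, 'k) mpoly set \<Rightarrow> enat" where
  "v_at X P I = Inf {enat d | d. \<exists>f \<in> homog X d. colon (mpoly_ring X) I f = P}"

definition v_number :: "'x set \<Rightarrow> ('x, 'k::field) mpoly set \<Rightarrow> enat" where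
  "v_number X I = Inf {v_at X P I | P. P \<in> Ass (mpoly_ring X) I}"


section \<open>Binomial edge ideals\<close>

datatype 'v xyvar = X 'v | Y 'v

definition xyvars :: "'v ugraph \<Rightarrow> 'v xyvar set" where
  "xyvars G = X ` verts G \<union> Y ` verts G"

abbreviation graph_ring :: "'v ugraph \<Rightarrow> ('v xyvar, 'k::field) mpoly ring" where
  "graph_ring G \<equiv> mpoly_ring (xyvars G)"

definition minor2 :: "'v \<Rightarrow> 'v \<Rightarrow> ('v xyvar, 'k::field) mpoly" where
  "minor2 i j = mvar (X i) * mvar (Y j) - mvar (X j) * mvar (Y i)"

definition binomial_edge_ideal :: "'v::linorder ugraph \<Rightarrow> ('v xyvar, 'k::field) mpoly set" where
  "binomial_edge_ideal G =
     genideal (graph_ring G) {minor2 i j | i j. {i, j} \<in> edges G \<and> i < j}"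

definition cut_prime ::
  "'v::linorder ugraph \<Rightarrow> 'v set \<Rightarrow> ('v xyvar, 'k::field) mpoly set" where
  "cut_prime G T =
     genideal (graph_ring G) (mvar ` (X ` T \<union> Y ` T)) <+>\<^bsub>graph_ring G\<^esub>
     genideal (graph_ring G)
       {minor2 i j | i j. i < j \<and> (i, j) \<in> same_component (del_verts G T)}"

text \<open>The coefficient field cannot be inferred from the graph, hence the type argument.\<close>

definition v_J :: "'k::field itself \<Rightarrow> 'v::linorder ugraph \<Rightarrow> enat" where
  "v_J _ G = v_number (xyvars G) (binomial_edge_ideal G :: ('v xyvar, 'k) mpoly set)"

definition v_cut :: "'k::field itself \<Rightarrow> 'v::linorder ugraph \<Rightarrow> 'v set \<Rightarrow> enat" where
  "v_cut _ G T =
     v_at (xyvars G) (cut_prime G T) (binomial_edge_ideal G :: ('v xyvar, 'k) mpoly set)"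

end

theory Submission
  imports Defs
begin

text \<open>Let \<open>J G\<close> be the binomial edge ideal of \<open>G\<close> with generators \<open>f i j\<close>. For a vertex \<open>v\<close>, let \<open>H\<close> be the graph in
  which the neighbourhood of \<open>v\<close> has been completed, let \<open>x\<close> and \<open>y\<close> be the variables of \<open>v\<close>, and let \<open>Q\<close> be the
  ideal \<open>(x, y) + J (G - v)\<close>. Both \<open>J H\<close> and \<open>Q\<close> contain \<open>J G\<close>, and the key fact is that their product lies
  in \<open>J G\<close>: for neighbours \<open>i\<close> and \<open>j\<close> of \<open>v\<close> one has \<open>x * f i j = x i * f v j - x j * f v i\<close>, and likewise for \<open>y\<close>
  (\<open>vertex_cone_times_J_complete\<close>). The three inequalities follow by transporting the element \<open>f\<close> that
  realises a prime \<open>P\<close> as a colon ideal.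

  Suppose \<open>P = (J H : f)\<close> does not contain \<open>x\<close>. Then \<open>P = (J G : x * f)\<close>, which gives (a). Suppose
  \<open>P = (J G : f)\<close> is the cut prime of \<open>T\<close>. If \<open>v\<close> is not in \<open>T\<close>, then \<open>x\<close> is not in \<open>P\<close>, and multiplying by \<open>x\<close>
  shows \<open>P = (J H : f)\<close>, which gives (b). If \<open>v\<close> is in \<open>T\<close>, then \<open>v\<close> has neighbours \<open>i\<close> and \<open>j\<close> in different components
  of \<open>G - T\<close>, so \<open>f i j\<close> is in \<open>J H\<close> but not in \<open>P\<close>; multiplying by it shows \<open>P = (Q : f)\<close>, and setting
  \<open>x\<close> and \<open>y\<close> to zero gives (c).

  Two ingredients remain. Cut primes are prime: they are the kernels of monomial parametrisations
  (\<open>cut_prime_eq_kernel\<close>). And an associated prime of \<open>J H\<close> does not contain \<open>x\<close>: more generally, \<open>x\<close> is a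
  nonzerodivisor modulo the binomial edge ideal of every graph in which \<open>v\<close> is simplicial
  (\<open>mvar_simplicial_nonzerodivisor\<close>). This uses the decomposition of \<open>J G\<close> as the intersection of \<open>J H\<close>
  and \<open>Q\<close> (\<open>J_complete_Int_vertex_cone\<close>), applied at the vertices that are not simplicial, until the graph is a
  disjoint union of complete graphs and its ideal a cut prime.\<close>

section \<open>Ideals of polynomial rings\<close>

abbreviation polys :: "'x set \<Rightarrow> ('x, 'k::field) mpoly set" where
  "polys A \<equiv> carrier (mpoly_ring A)"

lemma mpoly_ring_ring: "ring (mpoly_ring A)"
  using mpoly_ring_cring cring.axioms(1) by blast

lemma polys_zero [simp]: "0 \<in> polys A" and polys_one [simp]: "1 \<in> polys A"
  and polys_uminus [simp]: "- p \<in> polys A \<longleftrightarrow> p \<in> polys A"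
  by (simp_all add: mpoly_ring_simps)

lemma polys_diff: "p \<in> polys A \<Longrightarrow> q \<in> polys A \<Longrightarrow> p - q \<in> polys A"
  using mpoly_ring_add_closed[of p A "- q"] by simp

lemma polys_single: "Poly_Mapping.keys m \<subseteq> A \<Longrightarrow> Poly_Mapping.single m c \<in> polys A"
  by (simp add: mpoly_ring_simps)

lemma polys_mvar [simp]: "a \<in> A \<Longrightarrow> mvar a \<in> polys A"
  by (simp add: mvar_def polys_single)

lemma polys_mono: "A \<subseteq> A' \<Longrightarrow> p \<in> polys A \<Longrightarrow> p \<in> polys A'"
  by (auto simp: mpoly_ring_simps)

lemma mpoly_idealI:
  fixes I :: "('x, 'k::field) mpoly set"
  assumes carr: "I \<subseteq> polys A" and zero: "0 \<in> I"
    and add: "\<And>p q. p \<in> I \<Longrightarrow> q \<in> I \<Longrightarrow> p + q \<in> I"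
    and mult: "\<And>r p. r \<in> polys A \<Longrightarrow> p \<in> I \<Longrightarrow> r * p \<in> I"
  shows "ideal I (mpoly_ring A)"
proof -
  interpret ring "mpoly_ring A :: ('x, 'k) mpoly ring" by (rule mpoly_ring_ring)
  have inv: "\<ominus>\<^bsub>mpoly_ring A\<^esub> p = - p" if "p \<in> polys A" for p :: "('x, 'k) mpoly"
    using that by (intro minus_equality) (simp_all add: mpoly_ring_simps)
  have neg: "- p \<in> I" if "p \<in> I" for p
    using mult[of "- 1" p] that by simp
  show ?thesis
  proof (rule idealI[OF ring_axioms])
    show "subgroup I (add_monoid (mpoly_ring A :: ('x, 'k) mpoly ring))"
    proof (rule add.subgroupI)
      fix p assume "p \<in> I"
      then show "\<ominus>\<^bsub>mpoly_ring A\<^esub> p \<in> I" using carr inv neg by auto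
    qed (use carr zero add in \<open>auto simp: mpoly_ring_simps\<close>)
  next
    fix p r :: "('x, 'k) mpoly" assume "p \<in> I" "r \<in> polys A"
    then show "r \<otimes>\<^bsub>mpoly_ring A\<^esub> p \<in> I" and "p \<otimes>\<^bsub>mpoly_ring A\<^esub> r \<in> I"
      using mult by (simp_all add: mpoly_ring_simps mult.commute[of p r])
  qed
qed

lemma
  assumes "ideal I (mpoly_ring A :: ('x, 'k::field) mpoly ring)"
  shows mpoly_ideal_carrier: "p \<in> I \<Longrightarrow> p \<in> polys A"
    and mpoly_ideal_zero: "0 \<in> I"
    and mpoly_ideal_add: "p \<in> I \<Longrightarrow> q \<in> I \<Longrightarrow> p + q \<in> I"
    and mpoly_ideal_mult: "r \<in> polys A \<Longrightarrow> p \<in> I \<Longrightarrow> r * p \<in> I"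
    and mpoly_ideal_uminus: "p \<in> I \<Longrightarrow> - p \<in> I"
    and mpoly_ideal_diff: "p \<in> I \<Longrightarrow> q \<in> I \<Longrightarrow> p - q \<in> I"
proof -
  interpret ideal I "mpoly_ring A :: ('x, 'k) mpoly ring" by (rule assms)
  show "p \<in> I \<Longrightarrow> p \<in> polys A" by (rule Icarr)
  show z: "0 \<in> I"
    using additive_subgroup.zero_closed[OF is_additive_subgroup] by (simp add: mpoly_ring_simps)
  show add: "p \<in> I \<Longrightarrow> q \<in> I \<Longrightarrow> p + q \<in> I" for p q
    using additive_subgroup.a_closed[OF is_additive_subgroup, of p q] by (simp add: mpoly_ring_simps)
  show mult: "r \<in> polys A \<Longrightarrow> p \<in> I \<Longrightarrow> r * p \<in> I" for r p
    using I_l_closed[of p r] by (simp add: mpoly_ring_simps)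
  show neg: "p \<in> I \<Longrightarrow> - p \<in> I" for p
    using mult[of "- 1" p] by simp
  show "p \<in> I \<Longrightarrow> q \<in> I \<Longrightarrow> p - q \<in> I"
    using add[of p "- q"] neg by simp
qed

lemma mpoly_genideal_ideal: "S \<subseteq> polys A \<Longrightarrow> ideal (genideal (mpoly_ring A) S) (mpoly_ring A)"
  by (rule ring.genideal_ideal[OF mpoly_ring_ring])

lemma mpoly_genideal_minimal:
  "ideal I (mpoly_ring A) \<Longrightarrow> S \<subseteq> I \<Longrightarrow> genideal (mpoly_ring A) S \<subseteq> I"
  by (rule ring.genideal_minimal[OF mpoly_ring_ring])

lemma mpoly_genideal_self:
  "S \<subseteq> polys A \<Longrightarrow> S \<subseteq> genideal (mpoly_ring A) S"
  by (rule ring.genideal_self[OF mpoly_ring_ring])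

lemma ideal_colon_set:
  assumes I: "ideal I (mpoly_ring A)" and S: "S \<subseteq> polys A"
  shows "ideal {p \<in> polys A. \<forall>s\<in>S. p * s \<in> I} (mpoly_ring A)"
  by (rule mpoly_idealI)
    (auto simp: mpoly_ideal_zero[OF I] distrib_right mpoly_ideal_add[OF I] mult.assoc
      mpoly_ideal_mult[OF I] mpoly_ring_add_closed mpoly_ring_mult_closed)


lemma sum_of_monomials:
  "(\<Sum>m \<in> Poly_Mapping.keys p. Poly_Mapping.single m (Poly_Mapping.lookup p m)) = p"
  by (rule poly_mapping_eqI)
    (auto simp: lookup_sum lookup_single when_def in_keys_iff sum.delta)

lemma keys_add_nat:
  fixes m n :: "'x \<Rightarrow>\<^sub>0 nat"
  shows "Poly_Mapping.keys (m + n) = Poly_Mapping.keys m \<union> Poly_Mapping.keys n"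
  by (auto simp: in_keys_iff lookup_add)

lemma factor_variable:
  fixes m :: "'x \<Rightarrow>\<^sub>0 nat"
  assumes "a \<in> Poly_Mapping.keys m"
  obtains r where "m = Poly_Mapping.single a 1 + r"
proof
  show "m = Poly_Mapping.single a 1 + (m - Poly_Mapping.single a 1)"
    using assms by (intro poly_mapping_eqI)
      (auto simp: lookup_add lookup_minus lookup_single when_def in_keys_iff)
qed

lemma monomial_in_ideal:
  assumes I: "ideal I (mpoly_ring A)" and m: "Poly_Mapping.keys m \<subseteq> A"
    and a: "a \<in> Poly_Mapping.keys m" "mvar a \<in> I"
  shows "Poly_Mapping.single m b \<in> I"
proof -
  obtain s where s: "m = Poly_Mapping.single a 1 + s" using factor_variable[OF a(1)] .
  have "Poly_Mapping.single s b * mvar a \<in> I"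
    using m by (intro mpoly_ideal_mult[OF I] polys_single a(2)) (auto simp: s keys_add_nat)
  then show ?thesis by (simp add: s mvar_def mult_single add.commute)
qed

lemma additive_in_ideal:
  fixes D :: "('x, 'k::field) mpoly \<Rightarrow> ('y, 'k) mpoly"
  assumes I: "ideal I (mpoly_ring A')" and D: "\<And>p q. D (p + q) = D p + D q"
    and mono: "\<And>m b. Poly_Mapping.keys m \<subseteq> A \<Longrightarrow> D (Poly_Mapping.single m b) \<in> I"
    and p: "p \<in> polys A"
  shows "D p \<in> I"
proof -
  have D0: "D 0 = 0" using D[of 0 0] by simp
  have "D (\<Sum>m \<in> S. Poly_Mapping.single m (Poly_Mapping.lookup p m)) \<in> I"
    if "finite S" "S \<subseteq> Poly_Mapping.keys p" for S
    using that
  proof (induction S rule: finite_induct)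
    case empty
    then show ?case using mpoly_ideal_zero[OF I] by (simp add: D0)
  next
    case (insert m S)
    then have "D (Poly_Mapping.single m (Poly_Mapping.lookup p m)) \<in> I"
      using p by (intro mono) (simp add: mpoly_ring_simps)
    then show ?case using insert by (simp add: D mpoly_ideal_add[OF I])
  qed
  from this[of "Poly_Mapping.keys p"] show ?thesis by (simp add: sum_of_monomials)
qed


section \<open>Monomial substitutions\<close>

text \<open>A monomial substitution kills the monomials that involve a variable of \<open>B\<close> and transforms
  the exponent vectors of the others by \<open>h\<close>. For additive \<open>h\<close> this is a homomorphism; setting
  variables to zero (\<open>h\<close> the identity) and the parametrisation of the variety of a cut prime are of this
  kind. For an arbitrary \<open>h\<close>, such as a choice of representatives of monomials, it is still linear.\<close>

definition msubst ::
  "'x set \<Rightarrow> (('x \<Rightarrow>\<^sub>0 nat) \<Rightarrow> ('y \<Rightarrow>\<^sub>0 nat)) \<Rightarrow> ('x, 'k::field) mpoly \<Rightarrow> ('y, 'k) mpoly" where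
  "msubst B h p = (\<Sum>m \<in> Poly_Mapping.keys p.
     if Poly_Mapping.keys m \<inter> B = {} then Poly_Mapping.single (h m) (Poly_Mapping.lookup p m) else 0)"

lemma msubst_zero [simp]: "msubst B h 0 = 0"
  by (simp add: msubst_def)

lemma msubst_single:
  "msubst B h (Poly_Mapping.single m c) =
     (if Poly_Mapping.keys m \<inter> B = {} then Poly_Mapping.single (h m) c else 0)"
  by (simp add: msubst_def)

lemma msubst_add: "msubst B h (p + q) = msubst B h p + msubst B h q"
  unfolding msubst_def
  by (subst setsum_keys_plus_distrib) (auto simp: single_add)

lemma msubst_uminus: "msubst B h (- p) = - msubst B h p"
  using msubst_add[of B h p "- p"] by (simp add: eq_neg_iff_add_eq_0 add.commute)

lemma msubst_diff: "msubst B h (p - q) = msubst B h p - msubst B h q"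
  using msubst_add[of B h p "- q"] by (simp add: msubst_uminus)

lemma msubst_sum: "msubst B h (sum f S) = (\<Sum>s\<in>S. msubst B h (f s))"
  by (induction S rule: infinite_finite_induct) (simp_all add: msubst_add)

lemma msubst_mult:
  assumes "\<And>m n. h (m + n) = h m + h n"
  shows "msubst B h (p * q) = msubst B h p * msubst B h q"
proof -
  let ?t = "\<lambda>p m. Poly_Mapping.single m (Poly_Mapping.lookup p m)"
  have single: "msubst B h (?t p m * ?t q n) = msubst B h (?t p m) * msubst B h (?t q n)" for m n
    by (auto simp: mult_single msubst_single assms keys_add_nat)
  have "msubst B h (p * q) = msubst B h (sum (?t p) (Poly_Mapping.keys p) * sum (?t q) (Poly_Mapping.keys q))"
    by (simp only: sum_of_monomials)
  also have "\<dots> = msubst B h (sum (?t p) (Poly_Mapping.keys p)) * msubst B h (sum (?t q) (Poly_Mapping.keys q))"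
    by (simp only: sum_product msubst_sum single)
  finally show ?thesis by (simp only: sum_of_monomials)
qed

lemma ideal_msubst_preimage:
  fixes I :: "('y, 'k::field) mpoly set"
  assumes hom: "\<And>m n. h (m + n) = h m + h n" and I: "ideal I (mpoly_ring A')"
    and A: "\<And>p :: ('x, 'k) mpoly. p \<in> polys A \<Longrightarrow> msubst B h p \<in> polys A'"
  shows "ideal {p \<in> polys A. msubst B h p \<in> I} (mpoly_ring A)"
  by (rule mpoly_idealI)
    (auto simp: msubst_add msubst_mult[of h, OF hom] mpoly_ideal_zero[OF I] mpoly_ideal_add[OF I]
      mpoly_ring_add_closed mpoly_ring_mult_closed intro!: mpoly_ideal_mult[OF I] intro: A)

lemma primeideal_msubst_kernel:
  fixes h :: "('x \<Rightarrow>\<^sub>0 nat) \<Rightarrow> ('y::linorder \<Rightarrow>\<^sub>0 nat)"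
  assumes hom: "\<And>m n. h (m + n) = h m + h n"
  shows "primeideal {p \<in> polys A. msubst B h (p :: ('x, 'k::field) mpoly) = 0} (mpoly_ring A)"
proof (rule primeidealI)
  show "ideal {p \<in> polys A. msubst B h (p :: ('x, 'k) mpoly) = 0} (mpoly_ring A)"
    by (rule mpoly_idealI)
      (auto simp: msubst_add msubst_mult[of h, OF hom] mpoly_ring_add_closed mpoly_ring_mult_closed)
  have "msubst B h (1 :: ('x, 'k) mpoly) \<noteq> 0"
  proof -
    have "Poly_Mapping.keys (Poly_Mapping.single (h 0) (1 :: 'k)) \<noteq> {}" by simp
    then have "Poly_Mapping.single (h 0) (1 :: 'k) \<noteq> 0" by (metis keys_zero)
    then show ?thesis using msubst_single[of B h 0 "1 :: 'k"] by simp
  qed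
  then show "polys A \<noteq> {p \<in> polys A. msubst B h (p :: ('x, 'k) mpoly) = 0}"
    using polys_one by blast
next
  fix p q :: "('x, 'k) mpoly"
  assume "p \<in> polys A" "q \<in> polys A" "p \<otimes>\<^bsub>mpoly_ring A\<^esub> q \<in> {p \<in> polys A. msubst B h p = 0}"
  moreover from this have "msubst B h p * msubst B h q = 0"
    using msubst_mult[of h, OF hom, of B p q] by (simp add: mpoly_ring_simps(2))
  ultimately show "p \<in> {p \<in> polys A. msubst B h p = 0} \<or> q \<in> {p \<in> polys A. msubst B h p = 0}"
    by simp
qed (rule mpoly_ring_cring)

lemma keys_msubst:
  "Poly_Mapping.keys (msubst B h p) \<subseteq> h ` {m \<in> Poly_Mapping.keys p. Poly_Mapping.keys m \<inter> B = {}}"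
  unfolding msubst_def by (rule order.trans[OF keys_sum]) (auto split: if_splits)

text \<open>The monomials that are set to zero are multiples of variables in \<open>B\<close>.\<close>

lemma diff_msubst_id_in_ideal:
  fixes I :: "('x, 'k::field) mpoly set"
  assumes I: "ideal I (mpoly_ring A)" and B: "\<And>a. a \<in> B \<Longrightarrow> mvar a \<in> I"
    and p: "p \<in> polys A"
  shows "p - msubst B (\<lambda>m. m) p \<in> I"
proof (rule additive_in_ideal[OF I _ _ p])
  fix m :: "'x \<Rightarrow>\<^sub>0 nat" and b :: 'k assume m: "Poly_Mapping.keys m \<subseteq> A"
  show "Poly_Mapping.single m b - msubst B (\<lambda>m. m) (Poly_Mapping.single m b) \<in> I"
  proof (cases "Poly_Mapping.keys m \<inter> B = {}")
    case True
    then show ?thesis using mpoly_ideal_zero[OF I] by (simp add: msubst_single)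
  next
    case False
    then obtain a where "a \<in> Poly_Mapping.keys m" "a \<in> B" by blast
    then show ?thesis using False monomial_in_ideal[OF I m _ B] by (simp add: msubst_single)
  qed
qed (simp add: msubst_add)


section \<open>Toric ideals generated by two-minors\<close>

text \<open>Comparing leading monomials shows that a polynomial ring in linearly ordered variables has no zero
  divisors. Any order of the variables serves this purpose.\<close>

instantiation xyvar :: (linorder) linorder
begin

fun less_eq_xyvar :: "'a xyvar \<Rightarrow> 'a xyvar \<Rightarrow> bool" where
  "less_eq_xyvar (X i) (X j) = (i \<le> j)"
| "less_eq_xyvar (X i) (Y j) = True"
| "less_eq_xyvar (Y i) (X j) = False"
| "less_eq_xyvar (Y i) (Y j) = (i \<le> j)"

definition less_xyvar :: "'a xyvar \<Rightarrow> 'a xyvar \<Rightarrow> bool" where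
  "less_xyvar a b \<longleftrightarrow> a \<le> b \<and> \<not> b \<le> a"

instance
proof
  fix a b c :: "'a xyvar"
  show "a \<le> a" by (cases a) auto
  show "a \<le> b \<Longrightarrow> b \<le> c \<Longrightarrow> a \<le> c" by (cases a; cases b; cases c) auto
  show "a \<le> b \<Longrightarrow> b \<le> a \<Longrightarrow> a = b" by (cases a; cases b) auto
  show "a \<le> b \<or> b \<le> a" by (cases a; cases b) auto
qed (rule less_xyvar_def)

end

text \<open>Consider the parametrisation \<open>x i \<mapsto> z i\<close>, \<open>y i \<mapsto> z i * t (c i)\<close> of the pairs \<open>(x i, y i)\<close> that are
  proportional within each fibre of \<open>c\<close>. The parameters \<open>z i\<close> and \<open>t k\<close> are named \<open>X i\<close> and \<open>Y k\<close>, so that the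
  target is again a polynomial ring in these variables.\<close>

fun toric_var :: "('v \<Rightarrow> 'v) \<Rightarrow> 'v xyvar \<Rightarrow> ('v xyvar \<Rightarrow>\<^sub>0 nat)" where
  "toric_var c (X i) = Poly_Mapping.single (X i) 1"
| "toric_var c (Y i) = Poly_Mapping.single (X i) 1 + Poly_Mapping.single (Y (c i)) 1"

definition toric_exp :: "('v \<Rightarrow> 'v) \<Rightarrow> ('v xyvar \<Rightarrow>\<^sub>0 nat) \<Rightarrow> ('v xyvar \<Rightarrow>\<^sub>0 nat)" where
  "toric_exp c m = (\<Sum>a \<in> Poly_Mapping.keys m.
     Poly_Mapping.map ((*) (Poly_Mapping.lookup m a)) (toric_var c a))"

lemma lookup_map: "f 0 = 0 \<Longrightarrow> Poly_Mapping.lookup (Poly_Mapping.map f m) a = f (Poly_Mapping.lookup m a)"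
  by (simp add: map.rep_eq when_def)

lemma toric_exp_add: "toric_exp c (m + n) = toric_exp c m + toric_exp c n"
  unfolding toric_exp_def
  by (rule setsum_keys_plus_distrib)
    (auto intro!: poly_mapping_eqI simp: lookup_map lookup_add distrib_right)

lemma toric_exp_single: "toric_exp c (Poly_Mapping.single a (Suc 0)) = toric_var c a"
  by (auto intro!: poly_mapping_eqI simp: toric_exp_def lookup_map)

lemma keys_toric_exp:
  "Poly_Mapping.keys (toric_exp c m) = (\<Union>a \<in> Poly_Mapping.keys m. Poly_Mapping.keys (toric_var c a))"
proof (rule Set.set_eqI)
  fix b
  show "b \<in> Poly_Mapping.keys (toric_exp c m) \<longleftrightarrow>
      b \<in> (\<Union>a \<in> Poly_Mapping.keys m. Poly_Mapping.keys (toric_var c a))"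
    by (simp add: in_keys_iff toric_exp_def lookup_sum lookup_map)
qed

lemma X_in_keys_toric_exp:
  "X i \<in> Poly_Mapping.keys (toric_exp c m) \<longleftrightarrow> X i \<in> Poly_Mapping.keys m \<or> Y i \<in> Poly_Mapping.keys m"
  unfolding keys_toric_exp
proof (intro iffI; (elim UN_E)?)
  fix a assume "a \<in> Poly_Mapping.keys m" "X i \<in> Poly_Mapping.keys (toric_var c a)"
  then show "X i \<in> Poly_Mapping.keys m \<or> Y i \<in> Poly_Mapping.keys m"
    by (cases a) (auto simp: keys_add_nat)
qed (force simp: keys_add_nat)

lemma Y_in_keys_toric_exp:
  "Y k \<in> Poly_Mapping.keys (toric_exp c m) \<longleftrightarrow> (\<exists>j. Y j \<in> Poly_Mapping.keys m \<and> c j = k)"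
  unfolding keys_toric_exp
proof (intro iffI; (elim UN_E)?)
  fix a assume "a \<in> Poly_Mapping.keys m" "Y k \<in> Poly_Mapping.keys (toric_var c a)"
  then show "\<exists>j. Y j \<in> Poly_Mapping.keys m \<and> c j = k"
    by (cases a) (auto simp: keys_add_nat)
qed (force simp: keys_add_nat)

definition mdeg :: "('x \<Rightarrow>\<^sub>0 nat) \<Rightarrow> nat" where
  "mdeg m = (\<Sum>a \<in> Poly_Mapping.keys m. Poly_Mapping.lookup m a)"

lemma mdeg_add: "mdeg (m + n) = mdeg m + mdeg n"
  unfolding mdeg_def by (rule setsum_keys_plus_distrib) auto

lemma mdeg_single [simp]: "mdeg (Poly_Mapping.single a n) = n"
  by (simp add: mdeg_def)

lemma minor2_eq:
  "minor2 i j = Poly_Mapping.single (Poly_Mapping.single (X i) 1 + Poly_Mapping.single (Y j) 1) 1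
     - Poly_Mapping.single (Poly_Mapping.single (X j) 1 + Poly_Mapping.single (Y i) 1) 1"
  by (simp add: minor2_def mvar_def mult_single)

text \<open>If \<open>y i\<close> divides \<open>m'\<close>, the parameter \<open>t (c i)\<close> divides the common image, so \<open>m\<close> has a divisor
  \<open>y j\<close> with \<open>c j = c i\<close>. Then \<open>m\<close>, a multiple of \<open>x i\<close>, is one of \<open>x i * y j\<close>, and the minor of \<open>i\<close> and \<open>j\<close> replaces this
  factor by \<open>x j * y i\<close>.\<close>

lemma toric_exchange:
  fixes I :: "('v xyvar, 'k::field) mpoly set"
  assumes I: "ideal I (mpoly_ring A)"
    and minors: "\<And>i j. i \<in> U \<Longrightarrow> j \<in> U \<Longrightarrow> c i = c j \<Longrightarrow> minor2 i j \<in> I"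
    and U: "X ` U \<union> Y ` U \<subseteq> A"
    and m: "Poly_Mapping.keys m \<subseteq> X ` U \<union> Y ` U"
    and i: "X i \<in> Poly_Mapping.keys m" "Y i \<in> Poly_Mapping.keys m'"
    and eq: "toric_exp c m = toric_exp c m'"
  obtains n where "Poly_Mapping.keys n \<subseteq> X ` U \<union> Y ` U" "Y i \<in> Poly_Mapping.keys n"
    "toric_exp c n = toric_exp c m" "mdeg n = mdeg m"
    "Poly_Mapping.single m 1 - Poly_Mapping.single n 1 \<in> I"
proof -
  have "Y (c i) \<in> Poly_Mapping.keys (toric_exp c m)"
    using i(2) unfolding eq Y_in_keys_toric_exp by blast
  then obtain j where j: "Y j \<in> Poly_Mapping.keys m" "c j = c i"
    unfolding Y_in_keys_toric_exp by blast
  obtain r' where r': "m = Poly_Mapping.single (X i) 1 + r'"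
    using factor_variable[OF i(1)] .
  have "Y j \<in> Poly_Mapping.keys r'" using j(1) by (simp add: r' keys_add_nat)
  then obtain r where "r' = Poly_Mapping.single (Y j) 1 + r" by (rule factor_variable)
  with r' have r: "m = Poly_Mapping.single (X i) 1 + Poly_Mapping.single (Y j) 1 + r"
    by (simp add: add.assoc)
  have U': "i \<in> U" "j \<in> U" and rU: "Poly_Mapping.keys r \<subseteq> X ` U \<union> Y ` U"
    using m by (auto simp: r keys_add_nat)
  define n where "n = Poly_Mapping.single (X j) 1 + Poly_Mapping.single (Y i) 1 + r"
  have "Poly_Mapping.single r 1 * minor2 i j \<in> I"
    using minors[OF U'] j(2) rU U by (intro mpoly_ideal_mult[OF I] polys_single) auto
  then have "Poly_Mapping.single m 1 - Poly_Mapping.single n 1 \<in> I"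
    by (simp add: minor2_eq r n_def right_diff_distrib mult_single add.commute)
  moreover have "toric_exp c n = toric_exp c m"
    using j(2) by (simp add: n_def r toric_exp_add toric_exp_single ac_simps)
  ultimately show thesis
    using U' rU by (intro that[of n]) (auto simp: n_def r keys_add_nat mdeg_add)
qed

text \<open>Induction on the degree. A common variable of the two monomials can be cancelled. If there is
  none, some \<open>z i\<close> divides the common image, so one monomial is divisible by \<open>x i\<close> and the other by
  \<open>y i\<close>; one exchange makes \<open>y i\<close> a common variable.\<close>

lemma toric_monomials_congruent:
  fixes I :: "('v xyvar, 'k::field) mpoly set"
  assumes I: "ideal I (mpoly_ring A)"
    and minors: "\<And>i j. i \<in> U \<Longrightarrow> j \<in> U \<Longrightarrow> c i = c j \<Longrightarrow> minor2 i j \<in> I"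
    and U: "X ` U \<union> Y ` U \<subseteq> A"
    and "Poly_Mapping.keys m \<subseteq> X ` U \<union> Y ` U" "Poly_Mapping.keys m' \<subseteq> X ` U \<union> Y ` U"
    and "toric_exp c m = toric_exp c m'"
  shows "Poly_Mapping.single m 1 - Poly_Mapping.single m' 1 \<in> I"
  using assms(4-6)
proof (induction "mdeg m" arbitrary: m m' rule: less_induct)
  case less
  let ?U = "X ` U \<union> Y ` U"
  have shared: "Poly_Mapping.single n 1 - Poly_Mapping.single n' 1 \<in> I"
    if n: "Poly_Mapping.keys n \<subseteq> ?U" "Poly_Mapping.keys n' \<subseteq> ?U" "toric_exp c n = toric_exp c n'"
      "mdeg n = mdeg m" and a: "a \<in> Poly_Mapping.keys n" "a \<in> Poly_Mapping.keys n'" for n n' a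
  proof -
    obtain r where r: "n = Poly_Mapping.single a 1 + r" using factor_variable[OF a(1)] .
    obtain r' where r': "n' = Poly_Mapping.single a 1 + r'" using factor_variable[OF a(2)] .
    have "Poly_Mapping.single r 1 - Poly_Mapping.single r' 1 \<in> I"
      using n by (intro less.hyps) (auto simp: r r' keys_add_nat toric_exp_add mdeg_add simp flip: n(4))
    then have "mvar a * (Poly_Mapping.single r 1 - Poly_Mapping.single r' 1) \<in> I"
      using n(1) a(1) U by (intro mpoly_ideal_mult[OF I] polys_mvar) auto
    then show ?thesis by (simp add: r r' mvar_def right_diff_distrib mult_single)
  qed
  show ?case
  proof (cases "Poly_Mapping.keys m \<inter> Poly_Mapping.keys m' = {}")
    case False
    then show ?thesis using shared[of m m'] less.prems by blast
  next
    case disjoint: True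
    show ?thesis
    proof (cases "m = 0")
      case True
      then have "Poly_Mapping.keys (toric_exp c m') = {}"
        by (metis UN_empty keys_toric_exp keys_zero less.prems(3))
      then have "m' = 0"
        using X_in_keys_toric_exp Y_in_keys_toric_exp by (metis empty_iff equals0I keys_eq_empty xyvar.exhaust)
      then show ?thesis using True mpoly_ideal_zero[OF I] by simp
    next
      case False
      then obtain a where a: "a \<in> Poly_Mapping.keys m" by (metis equals0I keys_eq_empty)
      define i where "i = (case a of X i \<Rightarrow> i | Y i \<Rightarrow> i)"
      have "X i \<in> Poly_Mapping.keys (toric_exp c m)"
        using a unfolding X_in_keys_toric_exp i_def by (cases a) auto
      then have "X i \<in> Poly_Mapping.keys m' \<or> Y i \<in> Poly_Mapping.keys m'"
        and "X i \<in> Poly_Mapping.keys m \<or> Y i \<in> Poly_Mapping.keys m"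
        using less.prems(3) X_in_keys_toric_exp by metis+
      then consider "X i \<in> Poly_Mapping.keys m" "Y i \<in> Poly_Mapping.keys m'"
        | "X i \<in> Poly_Mapping.keys m'" "Y i \<in> Poly_Mapping.keys m"
        using disjoint by blast
      then show ?thesis
      proof cases
        case 1
        obtain n where n: "Poly_Mapping.keys n \<subseteq> ?U" "Y i \<in> Poly_Mapping.keys n"
          "toric_exp c n = toric_exp c m" "mdeg n = mdeg m"
          and I1: "Poly_Mapping.single m 1 - Poly_Mapping.single n 1 \<in> I"
          using toric_exchange[OF I minors U less.prems(1) 1 less.prems(3)] by blast
        have "Poly_Mapping.single n 1 - Poly_Mapping.single m' 1 \<in> I"
          using shared[of n m' "Y i"] n 1 less.prems by simp
        then show ?thesis using mpoly_ideal_add[OF I I1] by fastforce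
      next
        case 2
        obtain n where n: "Poly_Mapping.keys n \<subseteq> ?U" "Y i \<in> Poly_Mapping.keys n"
          "toric_exp c n = toric_exp c m'"
          and I1: "Poly_Mapping.single m' 1 - Poly_Mapping.single n 1 \<in> I"
          using toric_exchange[OF I minors U less.prems(2) 2 less.prems(3)[symmetric]] by blast
        have "Poly_Mapping.single m 1 - Poly_Mapping.single n 1 \<in> I"
          using shared[of m n "Y i"] n 2 less.prems by simp
        then show ?thesis using mpoly_ideal_diff[OF I _ I1] by fastforce
      qed
    qed
  qed
qed

text \<open>Modulo \<open>I\<close>, every monomial avoiding the variables of \<open>T\<close> may be replaced by a fixed representative of
  the monomials with the same image. The resulting normal form of a polynomial is a function of its
  image under the parametrisation, so it vanishes on the kernel.\<close>

lemma toric_kernel_subset: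
  fixes I :: "('v xyvar, 'k::field) mpoly set"
  assumes I: "ideal I (mpoly_ring (X ` V \<union> Y ` V))"
    and vars: "\<And>a. a \<in> X ` T \<union> Y ` T \<Longrightarrow> mvar a \<in> I"
    and minors: "\<And>i j. i \<in> V - T \<Longrightarrow> j \<in> V - T \<Longrightarrow> c i = c j \<Longrightarrow> minor2 i j \<in> I"
    and p: "p \<in> polys (X ` V \<union> Y ` V)" "msubst (X ` T \<union> Y ` T) (toric_exp c) p = 0"
  shows "p \<in> I"
proof -
  let ?U = "X ` (V - T) \<union> Y ` (V - T)" and ?B = "X ` T \<union> Y ` T" and ?h = "toric_exp c"
  define r where "r k = (SOME m. Poly_Mapping.keys m \<subseteq> ?U \<and> ?h m = k)" for k
  have "p - msubst {} r (msubst ?B ?h p) \<in> I"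
  proof (rule additive_in_ideal[OF I _ _ p(1)])
    fix m :: "'v xyvar \<Rightarrow>\<^sub>0 nat" and b :: 'k
    assume m: "Poly_Mapping.keys m \<subseteq> X ` V \<union> Y ` V"
    show "Poly_Mapping.single m b - msubst {} r (msubst ?B ?h (Poly_Mapping.single m b)) \<in> I"
    proof (cases "Poly_Mapping.keys m \<inter> ?B = {}")
      case True
      have mU: "Poly_Mapping.keys m \<subseteq> ?U"
      proof
        fix a assume a: "a \<in> Poly_Mapping.keys m"
        then have "a \<notin> ?B" "a \<in> X ` V \<union> Y ` V" using True m by auto
        then show "a \<in> ?U" by auto
      qed
      then have "Poly_Mapping.keys (r (?h m)) \<subseteq> ?U \<and> ?h (r (?h m)) = ?h m"
        unfolding r_def
        using someI[of "\<lambda>m'. Poly_Mapping.keys m' \<subseteq> ?U \<and> ?h m' = ?h m" m] by blast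
      then have "Poly_Mapping.single m 1 - Poly_Mapping.single (r (?h m)) 1 \<in> I"
        using mU by (intro toric_monomials_congruent[OF I, of "V - T" c]) (auto simp: minors)
      then have "Poly_Mapping.single 0 b * (Poly_Mapping.single m 1 - Poly_Mapping.single (r (?h m)) 1) \<in> I"
        by (intro mpoly_ideal_mult[OF I] polys_single) auto
      then show ?thesis using True by (simp add: msubst_single right_diff_distrib mult_single)
    next
      case False
      then obtain a where "a \<in> Poly_Mapping.keys m" "a \<in> ?B" by blast
      then show ?thesis using False monomial_in_ideal[OF I m _ vars] by (simp add: msubst_single)
    qed
  qed (simp add: msubst_add)
  then show ?thesis using p(2) by simp
qed


section \<open>Connected components and cut vertices\<close>

lemma simple_graph_edge:
  assumes "simple_graph G" "{i, j} \<in> edges G"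
  shows "i \<in> verts G" "j \<in> verts G" "i \<noteq> j"
  using assms unfolding simple_graph_def by (metis doubleton_eq_iff)+

lemma simple_graph_finite: "simple_graph G \<Longrightarrow> finite (verts G)"
  by (simp add: simple_graph_def)

lemma simple_graph_del: "simple_graph G \<Longrightarrow> simple_graph (del_verts G T)"
  unfolding simple_graph_def del_verts_def by fastforce

lemma simple_graph_complete:
  assumes "simple_graph G"
  shows "simple_graph (complete_nbrs G v)"
  unfolding simple_graph_def
proof (intro conjI ballI)
  show "finite (verts (complete_nbrs G v))"
    using simple_graph_finite[OF assms] by (simp add: complete_nbrs_def)
  fix e assume "e \<in> edges (complete_nbrs G v)"
  then consider "e \<in> edges G"
    | i j where "i \<in> nbrs G v" "j \<in> nbrs G v" "i \<noteq> j" "e = {i, j}"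
    unfolding complete_nbrs_def by auto
  then have "\<exists>i \<in> verts G. \<exists>j \<in> verts G. i \<noteq> j \<and> e = {i, j}"
  proof cases
    case 1
    then show ?thesis using assms by (simp add: simple_graph_def)
  next
    case 2
    then show ?thesis using simple_graph_edge(2)[OF assms] unfolding nbrs_def by blast
  qed
  then show "\<exists>i \<in> verts (complete_nbrs G v). \<exists>j \<in> verts (complete_nbrs G v). i \<noteq> j \<and> e = {i, j}"
    by (simp add: complete_nbrs_def)
qed

lemma del_verts_simps [simp]:
  "verts (del_verts G T) = verts G - T"
  "{i, j} \<in> edges (del_verts G T) \<longleftrightarrow> {i, j} \<in> edges G \<and> i \<notin> T \<and> j \<notin> T"
  by (auto simp: del_verts_def)

lemma complete_nbrs_simps [simp]:
  "verts (complete_nbrs G v) = verts G"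
  "{i, j} \<in> edges (complete_nbrs G v) \<longleftrightarrow>
     {i, j} \<in> edges G \<or> i \<in> nbrs G v \<and> j \<in> nbrs G v \<and> i \<noteq> j"
  by (auto simp: complete_nbrs_def doubleton_eq_iff)

lemma same_component_equiv: "equiv (verts G) (same_component G)"
proof (rule equivI)
  show "same_component G \<subseteq> verts G \<times> verts G" "refl_on (verts G) (same_component G)"
    by (auto simp: same_component_def refl_on_def)
  have "sym ({(a, b). {a, b} \<in> edges G}\<^sup>*)"
    by (rule sym_rtrancl) (auto simp: sym_def insert_commute)
  then show "sym (same_component G)"
    unfolding same_component_def sym_def by blast
  show "trans (same_component G)"
    by (auto simp: same_component_def trans_def intro: rtrancl_trans)
qed

lemma same_component_edge:
  "simple_graph G \<Longrightarrow> {i, j} \<in> edges G \<Longrightarrow> (i, j) \<in> same_component G"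
  by (auto simp: same_component_def dest: simple_graph_edge)

text \<open>If all neighbours of \<open>v\<close> were in one component of \<open>G - v\<close>, every path through \<open>v\<close> could be rerouted
  around \<open>v\<close>. Distinct components of \<open>G - v\<close> would then lie in distinct components of \<open>G\<close>, and removing
  \<open>v\<close> would not increase their number.\<close>

lemma cut_vertex_separates_nbrs:
  assumes G: "simple_graph G" and cut: "cut_vertex G v"
  obtains i j where "i \<in> nbrs G v" "j \<in> nbrs G v" "(i, j) \<notin> same_component (del_verts G {v})"
proof -
  let ?H = "del_verts G {v}"
  let ?r = "same_component ?H" and ?s = "same_component G"
  have False if conn: "\<And>i j. i \<in> nbrs G v \<Longrightarrow> j \<in> nbrs G v \<Longrightarrow> (i, j) \<in> ?r"
  proof -
    have r_trans: "(a, c) \<in> ?r" if "(a, b) \<in> ?r" "(b, c) \<in> ?r" for a b c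
      using that same_component_equiv[of ?H] by (meson equivE transE)
    \<comment> \<open>A path in \<open>G\<close> is followed in \<open>G - v\<close>; when it sits at \<open>v\<close>, a neighbour of \<open>v\<close> stands in for \<open>v\<close>.\<close>
    have reach: "(b \<noteq> v \<longrightarrow> (a, b) \<in> ?r) \<and> (b = v \<longrightarrow> (\<exists>i \<in> nbrs G v. (a, i) \<in> ?r))"
      if a: "a \<in> verts ?H" and "(a, b) \<in> {(a, b). {a, b} \<in> edges G}\<^sup>*" for a b
      using that(2)
    proof (induction rule: rtrancl_induct)
      case base
      have "(a, a) \<in> ?r" using a by (simp add: same_component_def)
      then show ?case using a by auto
    next
      case (step b c)
      have e: "{b, c} \<in> edges G" using step.hyps by simp
      show ?case
      proof (cases "b = v")
        case True
        then have "c \<in> nbrs G v" "c \<noteq> v"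
          using e simple_graph_edge(3)[OF G e] by (auto simp: nbrs_def)
        then show ?thesis using step.IH True conn r_trans by blast
      next
        case b: False
        then have ab: "(a, b) \<in> ?r" using step.IH by simp
        show ?thesis
        proof (cases "c = v")
          case True
          then have "b \<in> nbrs G v" using e by (simp add: nbrs_def insert_commute)
          then show ?thesis using True ab by blast
        next
          case False
          then have "(b, c) \<in> ?r"
            using b e by (intro same_component_edge simple_graph_del G) auto
          then show ?thesis using False ab r_trans by blast
        qed
      qed
    qed
    have sub: "?r \<subseteq> ?s"
      unfolding same_component_def
      by (auto elim!: rtrancl_mono[THEN subsetD, rotated])
    have eq: "?r `` {a} = ?s `` {a} \<inter> verts ?H" if "a \<in> verts ?H" for a
    proof (intro equalityI subsetI)
      fix b assume "b \<in> ?r `` {a}"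
      then show "b \<in> ?s `` {a} \<inter> verts ?H" using sub by (auto simp: same_component_def)
    next
      fix b assume "b \<in> ?s `` {a} \<inter> verts ?H"
      then show "b \<in> ?r `` {a}" using reach[OF that, of b] by (auto simp: same_component_def)
    qed
    have "components ?H \<subseteq> (\<lambda>C. C \<inter> verts ?H) ` components G"
    proof
      fix C assume "C \<in> components ?H"
      then obtain a where a: "a \<in> verts ?H" "C = ?r `` {a}"
        unfolding components_def by (auto elim: quotientE)
      then have "?s `` {a} \<in> components G" unfolding components_def by (auto intro: quotientI)
      then show "C \<in> (\<lambda>C. C \<inter> verts ?H) ` components G" using eq a by auto
    qed
    moreover have "finite (components G)"
      unfolding components_def
      using simple_graph_finite[OF G] same_component_equiv[of G]
      by (simp add: quotient_def)
    ultimately have "card (components ?H) \<le> card (components G)"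
      by (rule surj_card_le[rotated])
    then show False using cut by (simp add: cut_vertex_def)
  qed
  then show thesis using that by blast
qed

lemma cutset_separates_nbrs:
  assumes G: "simple_graph G" and T: "cutset G T" "v \<in> T"
  obtains i j where "i \<in> nbrs G v - T" "j \<in> nbrs G v - T" "(i, j) \<notin> same_component (del_verts G T)"
proof -
  let ?H = "del_verts G (T - {v})"
  have "cut_vertex ?H v" using T by (simp add: cutset_def)
  then obtain i j where ij: "i \<in> nbrs ?H v" "j \<in> nbrs ?H v"
      "(i, j) \<notin> same_component (del_verts ?H {v})"
    using cut_vertex_separates_nbrs simple_graph_del[OF G] by metis
  have "del_verts ?H {v} = del_verts G T"
    using T(2) by (auto simp: del_verts_def)
  moreover have "nbrs ?H v \<subseteq> nbrs G v - T"
  proof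
    fix i assume "i \<in> nbrs ?H v"
    then have "{v, i} \<in> edges G" "i \<notin> T - {v}" by (auto simp: nbrs_def)
    then show "i \<in> nbrs G v - T" using simple_graph_edge(3)[OF G] by (auto simp: nbrs_def)
  qed
  ultimately show thesis using ij that by (metis subsetD)
qed


section \<open>The primes of cutsets\<close>

lemma xyvars_del: "xyvars (del_verts G {v}) = xyvars G - {X v, Y v}"
  by (auto simp: xyvars_def)

lemma xyvars_complete [simp]: "xyvars (complete_nbrs G v) = xyvars G"
  by (simp add: xyvars_def)

lemma minor2_swap: "minor2 j i = - minor2 i j"
  by (simp add: minor2_def)

lemma minor2_same [simp]: "minor2 i i = 0"
  by (simp add: minor2_def)

lemma minor2_polys: "X i \<in> A \<Longrightarrow> Y i \<in> A \<Longrightarrow> X j \<in> A \<Longrightarrow> Y j \<in> A \<Longrightarrow> minor2 i j \<in> polys A"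
  unfolding minor2_def by (intro polys_diff mpoly_ring_mult_closed polys_mvar)

lemma minor2_graph_ring: "i \<in> verts G \<Longrightarrow> j \<in> verts G \<Longrightarrow> minor2 i j \<in> polys (xyvars G)"
  by (intro minor2_polys) (auto simp: xyvars_def)

definition component_rep :: "'v ugraph \<Rightarrow> 'v \<Rightarrow> 'v" where
  "component_rep G i = (SOME j. (i, j) \<in> same_component G)"

lemma component_rep_eq_iff:
  assumes "i \<in> verts G" "j \<in> verts G"
  shows "component_rep G i = component_rep G j \<longleftrightarrow> (i, j) \<in> same_component G"
proof
  have rep: "(k, component_rep G k) \<in> same_component G" if "k \<in> verts G" for k
    unfolding component_rep_def using that
    by (intro someI[of "\<lambda>j. (k, j) \<in> same_component G" k]) (simp add: same_component_def)
  show "(i, j) \<in> same_component G" if "component_rep G i = component_rep G j"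
    using rep[OF assms(1)] rep[OF assms(2)] that same_component_equiv[of G]
    by (metis equivE symE transE)
  assume "(i, j) \<in> same_component G"
  then have "same_component G `` {i} = same_component G `` {j}"
    using same_component_equiv equiv_class_eq by metis
  then have "(i, k) \<in> same_component G \<longleftrightarrow> (j, k) \<in> same_component G" for k by blast
  then show "component_rep G i = component_rep G j" unfolding component_rep_def by simp
qed

text \<open>The generic point of the variety of the cut prime: the pairs \<open>(x i, y i)\<close> with \<open>i\<close> in \<open>T\<close> vanish, and
  those of one component of \<open>G - T\<close> are proportional.\<close>

definition cut_param :: "'v ugraph \<Rightarrow> 'v set \<Rightarrow> ('v xyvar, 'k::field) mpoly \<Rightarrow> ('v xyvar, 'k) mpoly" where
  "cut_param G T = msubst (X ` T \<union> Y ` T) (toric_exp (component_rep (del_verts G T)))"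

lemma cut_param_mult: "cut_param G T (p * q) = cut_param G T p * cut_param G T q"
  unfolding cut_param_def by (rule msubst_mult) (rule toric_exp_add)

lemma cut_param_mvar_eq_0_iff: "cut_param G T (mvar a :: ('v xyvar, 'k::field) mpoly) = 0 \<longleftrightarrow> a \<in> X ` T \<union> Y ` T"
proof -
  have "Poly_Mapping.single m (1::'k) \<noteq> 0" for m :: "'v xyvar \<Rightarrow>\<^sub>0 nat"
    by (metis keys_single keys_zero insert_not_empty zero_neq_one)
  then show ?thesis by (simp add: cut_param_def mvar_def msubst_single)
qed

lemma cut_param_minor2_eq_0_iff:
  assumes "i \<in> verts G" "j \<in> verts G"
  shows "cut_param G T (minor2 i j :: ('v xyvar, 'k::field) mpoly) = 0 \<longleftrightarrow>
    i \<in> T \<or> j \<in> T \<or> (i, j) \<in> same_component (del_verts G T)"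
proof (cases "i \<in> T \<or> j \<in> T")
  case True
  then show ?thesis
    by (auto simp: minor2_eq cut_param_def msubst_diff msubst_single keys_add_nat)
next
  case False
  let ?c = "component_rep (del_verts G T)"
  let ?m = "\<lambda>k. Poly_Mapping.single (X i) 1 + Poly_Mapping.single (X j) 1
    + Poly_Mapping.single (Y (?c k)) (1::nat)"
  have "(X ` T \<union> Y ` T) \<inter> {X i, Y j} = {}" "(X ` T \<union> Y ` T) \<inter> {X j, Y i} = {}"
    using False by auto
  then have "cut_param G T (minor2 i j :: ('v xyvar, 'k) mpoly) =
      Poly_Mapping.single (?m j) 1 - Poly_Mapping.single (?m i) 1"
    using False by (auto simp: minor2_eq cut_param_def msubst_diff msubst_single keys_add_nat
        toric_exp_add toric_exp_single ac_simps)
  moreover have "Poly_Mapping.single (?m j) (1::'k) = Poly_Mapping.single (?m i) 1 \<longleftrightarrow> ?c i = ?c j"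
  proof
    assume "Poly_Mapping.single (?m j) (1::'k) = Poly_Mapping.single (?m i) 1"
    then have "Poly_Mapping.keys (Poly_Mapping.single (?m j) (1::'k)) =
        Poly_Mapping.keys (Poly_Mapping.single (?m i) (1::'k))"
      by simp
    then have "?m j = ?m i" by simp
    then have "Poly_Mapping.single (Y (?c j)) (1::nat) = Poly_Mapping.single (Y (?c i)) 1" by simp
    then have "Poly_Mapping.keys (Poly_Mapping.single (Y (?c j)) (1::nat)) =
        Poly_Mapping.keys (Poly_Mapping.single (Y (?c i)) (1::nat))"
      by (rule arg_cong)
    then show "?c i = ?c j" by simp
  qed simp
  ultimately show ?thesis
    using component_rep_eq_iff[of i "del_verts G T" j] assms False by simp
qed

text \<open>The generators of the cut prime vanish under the parametrisation, and
  \<open>toric_kernel_subset\<close> gives the converse. Mapping into an integral domain, the parametrisation has a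
  prime kernel; it also decides membership of variables and minors.\<close>

lemma cut_prime_eq_kernel:
  fixes G :: "'v::linorder ugraph"
  assumes T: "T \<subseteq> verts G"
  shows "(cut_prime G T :: ('v xyvar, 'k::field) mpoly set) = {p \<in> polys (xyvars G). cut_param G T p = 0}"
proof -
  let ?A = "mvar ` (X ` T \<union> Y ` T) :: ('v xyvar, 'k) mpoly set"
  let ?B = "{minor2 i j | i j. i < j \<and> (i, j) \<in> same_component (del_verts G T)} :: ('v xyvar, 'k) mpoly set"
  let ?K = "{p \<in> polys (xyvars G). cut_param G T p = 0} :: ('v xyvar, 'k) mpoly set"
  have sc: "i \<in> verts G - T \<and> j \<in> verts G - T" if "(i, j) \<in> same_component (del_verts G T)" for i j
    using that by (simp add: same_component_def)
  have A: "?A \<subseteq> ?K" and B: "?B \<subseteq> ?K"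
    using T sc
    by (auto simp: cut_param_mvar_eq_0_iff cut_param_minor2_eq_0_iff intro: minor2_graph_ring)
      (auto simp: xyvars_def intro!: polys_mvar)
  have K: "ideal ?K (graph_ring G)"
    unfolding cut_param_def
    by (rule primeideal.axioms(1), rule primeideal_msubst_kernel, rule toric_exp_add)
  have A': "?A \<subseteq> polys (xyvars G)" and B': "?B \<subseteq> polys (xyvars G)"
    by (rule subset_trans[OF A], blast) (rule subset_trans[OF B], blast)
  have iA: "ideal (genideal (graph_ring G) ?A) (graph_ring G)"
    and iB: "ideal (genideal (graph_ring G) ?B) (graph_ring G)"
    using A' B' by (simp_all add: mpoly_genideal_ideal)
  have iP: "ideal (cut_prime G T :: ('v xyvar, 'k) mpoly set) (graph_ring G)"
    unfolding cut_prime_def by (rule ring.add_ideals[OF mpoly_ring_ring iA iB])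
  have sum: "p \<in> cut_prime G T \<longleftrightarrow>
      (\<exists>a \<in> genideal (graph_ring G) ?A. \<exists>b \<in> genideal (graph_ring G) ?B. p = a + b)" for p
    unfolding cut_prime_def set_add_def' by (auto simp: mpoly_ring_simps)
  have AP: "?A \<subseteq> cut_prime G T"
  proof
    fix a assume "a \<in> ?A"
    then have "a \<in> genideal (graph_ring G) ?A" using mpoly_genideal_self[OF A'] by (rule subsetD[rotated])
    then show "a \<in> cut_prime G T" 
      unfolding sum by (intro bexI[of _ a] bexI[of _ 0]) (simp_all add: mpoly_ideal_zero[OF iB])
  qed
  have BP: "?B \<subseteq> cut_prime G T"
  proof
    fix b assume "b \<in> ?B"
    then have "b \<in> genideal (graph_ring G) ?B" using mpoly_genideal_self[OF B'] by (rule subsetD[rotated])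
    then show "b \<in> cut_prime G T" 
      unfolding sum by (intro bexI[of _ b] bexI[of _ 0]) (simp_all add: mpoly_ideal_zero[OF iA])
  qed
  show ?thesis
  proof
    show "cut_prime G T \<subseteq> ?K"
    proof
      fix p :: "('v xyvar, 'k) mpoly" assume "p \<in> cut_prime G T"
      then obtain a b where ab: "a \<in> genideal (graph_ring G) ?A" "b \<in> genideal (graph_ring G) ?B"
          and p: "p = a + b"
        unfolding sum by (elim bexE)
      show "p \<in> ?K"
        unfolding p
        by (intro mpoly_ideal_add[OF K] subsetD[OF mpoly_genideal_minimal[OF K A] ab(1)]
            subsetD[OF mpoly_genideal_minimal[OF K B] ab(2)])
    qed
    show "?K \<subseteq> cut_prime G T"
    proof
      fix p :: "('v xyvar, 'k) mpoly" assume "p \<in> ?K"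
      then have p: "p \<in> polys (X ` verts G \<union> Y ` verts G)"
          "msubst (X ` T \<union> Y ` T) (toric_exp (component_rep (del_verts G T))) p = 0"
        by (simp_all add: xyvars_def cut_param_def)
      have minors: "minor2 i j \<in> (cut_prime G T :: ('v xyvar, 'k) mpoly set)"
        if "i \<in> verts G - T" "j \<in> verts G - T"
          "component_rep (del_verts G T) i = component_rep (del_verts G T) j" for i j
      proof -
        have "(i, j) \<in> same_component (del_verts G T)" "(j, i) \<in> same_component (del_verts G T)"
          using that component_rep_eq_iff[of i "del_verts G T" j]
            component_rep_eq_iff[of j "del_verts G T" i] by simp_all
        then show ?thesis
        proof (cases i j rule: linorder_cases)
          case less
          then have "minor2 i j \<in> ?B"
            using \<open>(i, j) \<in> same_component _\<close>
            by (intro CollectI exI[of _ i] exI[of _ j] conjI refl)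
          then show ?thesis using BP by (rule subsetD[rotated])
        next
          case equal
          then show ?thesis using mpoly_ideal_zero[OF iP] by simp
        next
          case greater
          then have "minor2 j i \<in> ?B"
            using \<open>(j, i) \<in> same_component _\<close>
            by (intro CollectI exI[of _ j] exI[of _ i] conjI refl)
          then have "minor2 j i \<in> (cut_prime G T :: ('v xyvar, 'k) mpoly set)" using BP by (rule subsetD[rotated])
          then show ?thesis unfolding minor2_swap[of i j] by (rule mpoly_ideal_uminus[OF iP])
        qed
      qed
      show "p \<in> cut_prime G T"
      proof (rule toric_kernel_subset[where c = "component_rep (del_verts G T)",
            OF iP[unfolded xyvars_def] _ minors])
        show "mvar a \<in> (cut_prime G T :: ('v xyvar, 'k) mpoly set)" if "a \<in> X ` T \<union> Y ` T" for a
          using AP that by (rule subsetD[OF _ imageI])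
      qed (assumption | rule p)+
    qed
  qed
qed

lemma cut_prime_prime:
  assumes "T \<subseteq> verts G"
  shows "primeideal (cut_prime G T) (graph_ring G)"
  unfolding cut_prime_eq_kernel[OF assms] cut_param_def
  by (rule primeideal_msubst_kernel) (rule toric_exp_add)

section \<open>Setting the variables of a vertex to zero\<close>

text \<open>The retraction onto the polynomial ring of \<open>G - v\<close>.\<close>

definition kill :: "'v \<Rightarrow> ('v xyvar, 'k::field) mpoly \<Rightarrow> ('v xyvar, 'k) mpoly" where
  "kill v = msubst {X v, Y v} (\<lambda>m. m)"

lemma kill_mult: "kill v (p * q) = kill v p * kill v q"
  unfolding kill_def by (rule msubst_mult) (rule refl)

lemma kill_mvar: "kill v (mvar a) = (if a \<in> {X v, Y v} then 0 else mvar a)"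
  by (auto simp: kill_def mvar_def msubst_single)

lemma kill_minor2: "kill v (minor2 i j) = (if v \<in> {i, j} then 0 else minor2 i j)"
proof -
  have "kill v (minor2 i j) = kill v (mvar (X i)) * kill v (mvar (Y j)) - kill v (mvar (X j)) * kill v (mvar (Y i))"
    by (simp only: minor2_def kill_mult[symmetric]) (simp add: kill_def msubst_diff)
  then show ?thesis by (auto simp: kill_mvar minor2_def)
qed

lemma kill_polys: "p \<in> polys (xyvars G) \<Longrightarrow> kill v p \<in> polys (xyvars (del_verts G {v}))"
  using keys_msubst[of "{X v, Y v}" "\<lambda>m. m" p]
  unfolding kill_def mpoly_ring_simps xyvars_del by blast

lemma polys_del: "p \<in> polys (xyvars (del_verts G T)) \<Longrightarrow> p \<in> polys (xyvars G)"
  by (rule polys_mono) (auto simp: xyvars_def)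

lemma kill_id:
  assumes "p \<in> polys (xyvars (del_verts G {v}))"
  shows "kill v p = p"
proof -
  have "Poly_Mapping.keys m \<inter> {X v, Y v} = {}" if "m \<in> Poly_Mapping.keys p" for m
    using assms that unfolding mpoly_ring_simps xyvars_del by blast
  then have "kill v p = (\<Sum>m \<in> Poly_Mapping.keys p. Poly_Mapping.single m (Poly_Mapping.lookup p m))"
    unfolding kill_def msubst_def by (intro sum.cong) auto
  then show ?thesis by (simp only: sum_of_monomials)
qed


section \<open>Binomial edge ideals\<close>

abbreviation J :: "'v::linorder ugraph \<Rightarrow> ('v xyvar, 'k::field) mpoly set" where
  "J \<equiv> binomial_edge_ideal"

lemma J_gens_polys:
  assumes "simple_graph G"
  shows "{minor2 i j | i j. {i, j} \<in> edges G \<and> i < j} \<subseteq> polys (xyvars G)"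
proof
  fix p :: "('a xyvar, 'b) mpoly"
  assume "p \<in> {minor2 i j | i j. {i, j} \<in> edges G \<and> i < j}"
  then obtain i j where "p = minor2 i j" "{i, j} \<in> edges G" by blast
  then show "p \<in> polys (xyvars G)"
    using simple_graph_edge(1,2)[OF assms] by (simp add: minor2_graph_ring)
qed

lemma J_ideal: "simple_graph G \<Longrightarrow> ideal (J G) (graph_ring G)"
  unfolding binomial_edge_ideal_def by (intro mpoly_genideal_ideal J_gens_polys)

lemma J_subsetI:
  fixes I :: "('v::linorder xyvar, 'k::field) mpoly set"
  assumes "ideal I (graph_ring G)"
    and "\<And>i j. {i, j} \<in> edges G \<Longrightarrow> minor2 i j \<in> I"
  shows "J G \<subseteq> I"
  unfolding binomial_edge_ideal_def
proof (rule mpoly_genideal_minimal[OF assms(1)], rule subsetI)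
  fix p :: "('v xyvar, 'k) mpoly"
  assume "p \<in> {minor2 i j | i j. {i, j} \<in> edges G \<and> i < j}"
  then obtain i j where "p = minor2 i j" "{i, j} \<in> edges G" by blast
  then show "p \<in> I" using assms(2) by simp
qed

lemma minor2_in_J:
  fixes G :: "'v::linorder ugraph"
  assumes G: "simple_graph G" and e: "{i, j} \<in> edges G"
  shows "(minor2 i j :: ('v xyvar, 'k::field) mpoly) \<in> J G"
proof -
  have lt: "(minor2 a b :: ('v xyvar, 'k) mpoly) \<in> J G" if "{a, b} \<in> edges G" "a < b" for a b
    unfolding binomial_edge_ideal_def
    using that by (intro subsetD[OF mpoly_genideal_self[OF J_gens_polys[OF G]]] CollectI
      exI[of _ a] exI[of _ b] conjI refl)
  show ?thesis
  proof (cases i j rule: linorder_cases)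
    case less
    then show ?thesis using e by (intro lt)
  next
    case equal
    then show ?thesis using simple_graph_edge(3)[OF G e] by simp
  next
    case greater
    then have "(minor2 j i :: ('v xyvar, 'k) mpoly) \<in> J G"
      using e by (intro lt) (simp_all add: insert_commute)
    then show ?thesis unfolding minor2_swap[of i j] by (rule mpoly_ideal_uminus[OF J_ideal[OF G]])
  qed
qed

lemma J_subset_cut_prime:
  assumes G: "simple_graph G" and T: "T \<subseteq> verts G"
  shows "J G \<subseteq> cut_prime G T"
proof (rule J_subsetI)
  show "ideal (cut_prime G T) (graph_ring G)"
    by (rule primeideal.axioms(1)[OF cut_prime_prime[OF T]])
  fix i j assume e: "{i, j} \<in> edges G"
  then have V: "i \<in> verts G" "j \<in> verts G" by (rule simple_graph_edge[OF G])+
  have "i \<in> T \<or> j \<in> T \<or> (i, j) \<in> same_component (del_verts G T)"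
    using same_component_edge[OF simple_graph_del[OF G], of i j T] e by auto
  then show "minor2 i j \<in> cut_prime G T"
    unfolding cut_prime_eq_kernel[OF T] mem_Collect_eq cut_param_minor2_eq_0_iff[OF V]
    using minor2_graph_ring[OF V] by blast
qed

lemma J_del_subset:
  fixes G :: "'v::linorder ugraph"
  assumes G: "simple_graph G"
  shows "J (del_verts G {v}) \<subseteq> (J G :: ('v xyvar, 'k::field) mpoly set)"
proof -
  have "J (del_verts G {v}) \<subseteq> {p \<in> polys (xyvars (del_verts G {v})). p \<in> (J G :: ('v xyvar, 'k) mpoly set)}"
  proof (rule J_subsetI)
    note I = J_ideal[OF G]
    show "ideal {p \<in> polys (xyvars (del_verts G {v})). p \<in> (J G :: ('v xyvar, 'k) mpoly set)}
        (graph_ring (del_verts G {v}))"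
      by (rule mpoly_idealI)
        (auto intro: mpoly_ideal_zero[OF I] mpoly_ideal_add[OF I] mpoly_ideal_mult[OF I]
          mpoly_ring_add_closed mpoly_ring_mult_closed polys_del)
    fix i j assume e: "{i, j} \<in> edges (del_verts G {v})"
    show "minor2 i j \<in> {p \<in> polys (xyvars (del_verts G {v})). p \<in> (J G :: ('v xyvar, 'k) mpoly set)}"
      using e simple_graph_edge[OF simple_graph_del[OF G] e]
      by (simp add: minor2_in_J[OF G] minor2_graph_ring)
  qed
  then show ?thesis by blast
qed

text \<open>This is the ideal generated by the two variables of \<open>v\<close> and by the binomial edge ideal of \<open>G - v\<close>.
  As a preimage under the retraction it comes with a membership test.\<close>

definition vertex_cone :: "'v::linorder ugraph \<Rightarrow> 'v \<Rightarrow> ('v xyvar, 'k::field) mpoly set" where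
  "vertex_cone G v = {p \<in> polys (xyvars G). kill v p \<in> J (del_verts G {v})}"

lemma vertex_cone_ideal: "simple_graph G \<Longrightarrow> ideal (vertex_cone G v) (graph_ring G)"
  unfolding vertex_cone_def kill_def
  by (rule ideal_msubst_preimage[OF refl J_ideal[OF simple_graph_del] kill_polys[unfolded kill_def]])

lemma J_subset_vertex_cone:
  fixes G :: "'v::linorder ugraph"
  assumes G: "simple_graph G"
  shows "(J G :: ('v xyvar, 'k::field) mpoly set) \<subseteq> vertex_cone G v"
proof (rule J_subsetI[OF vertex_cone_ideal[OF G]])
  fix i j assume e: "{i, j} \<in> edges G"
  have "kill v (minor2 i j) \<in> (J (del_verts G {v}) :: ('v xyvar, 'k) mpoly set)"
  proof (cases "v \<in> {i, j}")
    case True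
    then show ?thesis
      using mpoly_ideal_zero[OF J_ideal[OF simple_graph_del[OF G, of "{v}"]]] by (simp add: kill_minor2)
  next
    case False
    then show ?thesis
      using minor2_in_J[OF simple_graph_del[OF G, of "{v}"], of i j] e by (auto simp: kill_minor2)
  qed
  then show "minor2 i j \<in> (vertex_cone G v :: ('v xyvar, 'k) mpoly set)"
    using simple_graph_edge[OF G e] by (simp add: vertex_cone_def minor2_graph_ring)
qed

lemma J_subset_J_complete:
  assumes G: "simple_graph G"
  shows "J G \<subseteq> J (complete_nbrs G v)"
proof (rule J_subsetI)
  show "ideal (J (complete_nbrs G v)) (graph_ring G)"
    using J_ideal[OF simple_graph_complete[OF G], of v] by simp
qed (simp add: minor2_in_J simple_graph_complete[OF G])

text \<open>For neighbours \<open>i\<close> and \<open>j\<close> of \<open>v\<close>, the Pluecker-type identity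
  \<open>x v * f i j = x i * f v j - x j * f v i\<close> and its analogue for \<open>y\<close> put the multiples of the new
  generator \<open>f i j\<close> by the variables of \<open>v\<close> into the ideal of \<open>G\<close>.\<close>

lemma mvar_times_J_complete:
  fixes G :: "'v::linorder ugraph"
  assumes G: "simple_graph G" and v: "v \<in> verts G"
    and p: "p \<in> J (complete_nbrs G v)" and a: "a \<in> {X v, Y v}"
  shows "(mvar a :: ('v xyvar, 'k::field) mpoly) * p \<in> J G"
proof -
  note I = J_ideal[OF G]
  let ?C = "{p \<in> polys (xyvars G). \<forall>s \<in> {mvar a}. p * s \<in> J G} :: ('v xyvar, 'k) mpoly set"
  have aV: "a \<in> xyvars G" using a v by (auto simp: xyvars_def)
  have "J (complete_nbrs G v) \<subseteq> ?C"
  proof (rule J_subsetI)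
    show "ideal ?C (graph_ring (complete_nbrs G v))"
      using ideal_colon_set[OF I, of "{mvar a}"] aV by simp
    fix i j assume e: "{i, j} \<in> edges (complete_nbrs G v)"
    have ij: "i \<in> verts G" "j \<in> verts G"
      using simple_graph_edge(1,2)[OF simple_graph_complete[OF G] e] by simp_all
    have "mvar a * (minor2 i j :: ('v xyvar, 'k) mpoly) \<in> J G"
    proof (cases "{i, j} \<in> edges G")
      case True
      then show ?thesis using aV by (intro mpoly_ideal_mult[OF I] minor2_in_J[OF G]) simp_all
    next
      case False
      then have "{v, i} \<in> edges G" "{v, j} \<in> edges G" using e by (auto simp: nbrs_def)
      then have m: "(minor2 v i :: ('v xyvar, 'k) mpoly) \<in> J G" "(minor2 v j :: ('v xyvar, 'k) mpoly) \<in> J G"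
        by (simp_all add: minor2_in_J[OF G])
      \<comment> \<open>The name of the letter of \<open>a\<close>, so that the identities for \<open>x\<close> and \<open>y\<close> become one.\<close>
      define z where "z = (if a = X v then X else Y :: 'v \<Rightarrow> 'v xyvar)"
      have "(mvar a :: ('v xyvar, 'k) mpoly) * minor2 i j = mvar (z i) * minor2 v j - mvar (z j) * minor2 v i"
        using a by (auto simp: z_def minor2_def algebra_simps)
      also have "\<dots> \<in> J G"
        using ij by (intro mpoly_ideal_diff[OF I] mpoly_ideal_mult[OF I] m polys_mvar)
          (auto simp: z_def xyvars_def)
      finally show ?thesis .
    qed
    then show "minor2 i j \<in> ?C" using ij by (simp add: minor2_graph_ring mult.commute)
  qed
  then show ?thesis using p by (auto simp: mult.commute)
qed

text \<open>An element of the cone is the sum of its retraction, which lies in the ideal of \<open>G - v\<close> and hence in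
  that of \<open>G\<close>, and of a combination of the two variables of \<open>v\<close>, which multiply the ideal of the completed
  graph into that of \<open>G\<close>.\<close>

lemma vertex_cone_times_J_complete:
  fixes G :: "'v::linorder ugraph"
  assumes G: "simple_graph G" and v: "v \<in> verts G"
    and p: "p \<in> vertex_cone G v" and q: "q \<in> J (complete_nbrs G v)"
  shows "(p :: ('v xyvar, 'k::field) mpoly) * q \<in> J G"
proof -
  let ?C = "{p \<in> polys (xyvars G). \<forall>s \<in> {q}. p * s \<in> J G} :: ('v xyvar, 'k) mpoly set"
  have qV: "q \<in> polys (xyvars G)"
    using mpoly_ideal_carrier[OF J_ideal[OF simple_graph_complete[OF G]] q] by simp
  have C: "ideal ?C (graph_ring G)"
    using qV by (intro ideal_colon_set J_ideal G) simp
  have pV: "p \<in> polys (xyvars G)" and "kill v p \<in> J G"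
    using p subsetD[OF J_del_subset[OF G]] by (auto simp: vertex_cone_def)
  then have "kill v p \<in> ?C"
    using mpoly_ideal_mult[OF J_ideal[OF G] qV, of "kill v p"] polys_del[OF kill_polys[OF pV]]
    by (simp add: mult.commute)
  moreover have "p - kill v p \<in> ?C"
    unfolding kill_def
  proof (rule diff_msubst_id_in_ideal[OF C _ pV])
    fix a assume a: "a \<in> {X v, Y v}"
    then have "a \<in> xyvars G" using v by (auto simp: xyvars_def)
    then show "mvar a \<in> ?C" using mvar_times_J_complete[OF G v q a] by simp
  qed
  ultimately have "kill v p + (p - kill v p) \<in> ?C" by (rule mpoly_ideal_add[OF C])
  then show ?thesis by simp
qed

text \<open>Modulo the ideal of \<open>G\<close>, the retraction does not change the elements of the ideal of the completed graph:
  the minors of the new edges do not involve \<open>v\<close>, and changing their coefficients by multiples of the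
  variables of \<open>v\<close> has no effect. If the element also lies in the cone, its retraction is in the ideal of
  \<open>G - v\<close>, and thus in that of \<open>G\<close>.\<close>

lemma J_complete_Int_vertex_cone:
  fixes G :: "'v::linorder ugraph"
  assumes G: "simple_graph G" and v: "v \<in> verts G"
  shows "J (complete_nbrs G v) \<inter> vertex_cone G v \<subseteq> (J G :: ('v xyvar, 'k::field) mpoly set)"
proof -
  let ?H = "complete_nbrs G v"
  note I = J_ideal[OF G]
  have JH: "ideal (J ?H :: ('v xyvar, 'k) mpoly set) (graph_ring G)"
    using J_ideal[OF simple_graph_complete[OF G], of v] by simp
  let ?D = "{p \<in> J ?H. p - kill v p \<in> J G} :: ('v xyvar, 'k) mpoly set"
  have diff: "(r - kill v r) * p \<in> J G" if r: "r \<in> polys (xyvars G)" and p: "p \<in> J ?H"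
    for r p :: "('v xyvar, 'k) mpoly"
  proof -
    have "kill v (r - kill v r) = 0"
      using kill_id[OF kill_polys[OF r], of v] by (simp add: kill_def msubst_diff)
    then have "r - kill v r \<in> vertex_cone G v"
      using r polys_del[OF kill_polys[OF r]] mpoly_ideal_zero[OF J_ideal[OF simple_graph_del[OF G]]]
      by (simp add: vertex_cone_def polys_diff)
    then show ?thesis using p by (rule vertex_cone_times_J_complete[OF G v])
  qed
  have "J ?H \<subseteq> ?D"
  proof (rule J_subsetI)
    show "ideal ?D (graph_ring ?H)"
      unfolding xyvars_complete
    proof (rule mpoly_idealI)
      show "?D \<subseteq> polys (xyvars G)" using mpoly_ideal_carrier[OF JH] by blast
      show "0 \<in> ?D" using mpoly_ideal_zero[OF JH] mpoly_ideal_zero[OF I] by (simp add: kill_def)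
    next
      fix p q assume pq: "p \<in> ?D" "q \<in> ?D"
      then have "(p - kill v p) + (q - kill v q) \<in> J G" by (intro mpoly_ideal_add[OF I]) simp_all
      moreover have "(p - kill v p) + (q - kill v q) = p + q - kill v (p + q)"
        by (simp add: kill_def msubst_add)
      ultimately show "p + q \<in> ?D" using pq by (simp add: mpoly_ideal_add[OF JH])
    next
      fix r p :: "('v xyvar, 'k) mpoly" assume r: "r \<in> polys (xyvars G)" and p: "p \<in> ?D"
      have "r * p - kill v (r * p) = (r - kill v r) * p + kill v r * (p - kill v p)"
        by (simp add: kill_mult algebra_simps)
      also have "\<dots> \<in> J G"
        using p r by (intro mpoly_ideal_add[OF I] diff mpoly_ideal_mult[OF I] polys_del[OF kill_polys[OF r]]) simp_all
      finally show "r * p \<in> ?D" using mpoly_ideal_mult[OF JH r] p by simp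
    qed
    fix i j assume e: "{i, j} \<in> edges ?H"
    have "minor2 i j - kill v (minor2 i j) \<in> (J G :: ('v xyvar, 'k) mpoly set)"
    proof (cases "{i, j} \<in> edges G")
      case True
      then show ?thesis
        by (simp add: kill_minor2 minor2_in_J[OF G True] mpoly_ideal_zero[OF I])
    next
      case False
      then have "{v, i} \<in> edges G" "{v, j} \<in> edges G" using e by (auto simp: nbrs_def)
      then have "v \<noteq> i" "v \<noteq> j" by (simp_all add: simple_graph_edge(3)[OF G])
      then show ?thesis by (simp add: kill_minor2 mpoly_ideal_zero[OF I])
    qed
    then show "minor2 i j \<in> ?D" using minor2_in_J[OF simple_graph_complete[OF G] e] by simp
  qed
  moreover have "p \<in> J G" if "p \<in> ?D" "p \<in> vertex_cone G v" for p :: "('v xyvar, 'k) mpoly"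
  proof -
    have "kill v p \<in> J G" using that(2) J_del_subset[OF G, of v] by (auto simp: vertex_cone_def)
    then have "(p - kill v p) + kill v p \<in> J G" using that(1) by (intro mpoly_ideal_add[OF I]) simp_all
    then show ?thesis by simp
  qed
  ultimately show ?thesis by blast
qed


section \<open>Simplicial vertices\<close>

definition simplicial :: "'v ugraph \<Rightarrow> 'v \<Rightarrow> bool" where
  "simplicial G v \<longleftrightarrow> (\<forall>i \<in> nbrs G v. \<forall>j \<in> nbrs G v. i \<noteq> j \<longrightarrow> {i, j} \<in> edges G)"

lemma simplicial_complete_nbrs: "simple_graph G \<Longrightarrow> simplicial (complete_nbrs G v) v"
  using simple_graph_edge(3)[of G v v]
  by (auto simp: simplicial_def nbrs_def)

text \<open>Completing the neighbourhood of \<open>w\<close> gives \<open>v\<close> new neighbours only if \<open>v\<close> and \<open>w\<close> are adjacent. In that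
  case the old and the new neighbours of \<open>v\<close> other than \<open>w\<close> are all neighbours of \<open>w\<close>, since those of \<open>v\<close>
  form a clique.\<close>

lemma simplicial_complete_nbrs_other:
  assumes "simplicial G v"
  shows "simplicial (complete_nbrs G w) v"
  unfolding simplicial_def
proof (intro ballI impI)
  fix i j assume i: "i \<in> nbrs (complete_nbrs G w) v" and j: "j \<in> nbrs (complete_nbrs G w) v" and ne: "i \<noteq> j"
  have mem: "k \<in> nbrs G v \<or> v \<in> nbrs G w \<and> k \<in> nbrs G w" if "k \<in> nbrs (complete_nbrs G w) v" for k
    using that by (auto simp: nbrs_def)
  have clique: "{a, b} \<in> edges G" if "a \<in> nbrs G v" "b \<in> nbrs G v" "a \<noteq> b" for a b
    using assms that by (simp add: simplicial_def)
  have swap: "w \<in> nbrs G v" if "v \<in> nbrs G w" using that by (simp add: nbrs_def insert_commute)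
  show "{i, j} \<in> edges (complete_nbrs G w)"
    using mem[OF i] mem[OF j] swap clique[of i j] clique[of w i] clique[of w j] ne
    by (cases "i = w"; cases "j = w") (auto simp: nbrs_def insert_commute)
qed

lemma simplicial_del: "simplicial G v \<Longrightarrow> simplicial (del_verts G T) v"
  by (auto simp: simplicial_def nbrs_def)

lemma all_simplicial_edge:
  assumes G: "simple_graph G" and simp: "\<And>w. w \<in> verts G \<Longrightarrow> simplicial G w"
    and ij: "(i, j) \<in> same_component G" "i \<noteq> j"
  shows "{i, j} \<in> edges G"
proof -
  have "(i, j) \<in> {(a, b). {a, b} \<in> edges G}\<^sup>*" using ij by (simp add: same_component_def)
  then have "j = i \<or> {i, j} \<in> edges G"
  proof (induction rule: rtrancl_induct)
    case (step b c)
    have bc: "{b, c} \<in> edges G" using step.hyps by simp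
    then have b: "simplicial G b" using simp simple_graph_edge[OF G] by blast
    show ?case
    proof (cases "b = i \<or> c = i")
      case False
      then have "i \<in> nbrs G b" "c \<in> nbrs G b" using step.IH bc by (auto simp: nbrs_def insert_commute)
      then show ?thesis using b False by (auto simp: simplicial_def)
    qed (use bc in auto)
  qed simp
  then show ?thesis using ij(2) by blast
qed

lemma del_verts_empty: "del_verts G {} = G"
  by (simp add: del_verts_def)

text \<open>If some vertex \<open>w\<close> is not simplicial, then \<open>J_complete_Int_vertex_cone\<close> writes the ideal as the
  intersection of the ideal of a graph with more edges and the cone over the ideal of a graph with fewer
  vertices; \<open>v\<close> is simplicial in both. If all vertices are simplicial, adjacency is transitive, and the ideal
  is the cut prime of the empty cutset, which contains no variable.\<close>

lemma mvar_simplicial_nonzerodivisor: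
  fixes G :: "'v::linorder ugraph"
  assumes "simple_graph G" "v \<in> verts G" "simplicial G v" "p \<in> polys (xyvars G)"
    and "mvar (X v) * p \<in> J G"
  shows "(p :: ('v xyvar, 'k::field) mpoly) \<in> J G"
  using assms
proof (induction "card {(i, j) \<in> verts G \<times> verts G. {i, j} \<notin> edges G}" arbitrary: G p rule: less_induct)
  case less
  note G = \<open>simple_graph G\<close> and v = \<open>v \<in> verts G\<close>
  \<comment> \<open>The pairs \<open>(w, w)\<close> count as well, so that deleting a vertex always decreases the measure.\<close>
  let ?N = "\<lambda>G. {(i, j) \<in> verts G \<times> verts G. {i, j} \<notin> edges G}"
  have fin: "finite (?N G)"
    by (rule finite_subset[of _ "verts G \<times> verts G"]) (auto simp: simple_graph_finite[OF G])
  show ?case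
  proof (cases "\<forall>w \<in> verts G. simplicial G w")
    case True
    have P: "(J G :: ('v xyvar, 'k) mpoly set) = cut_prime G {}"
    proof
      show "J G \<subseteq> cut_prime G {}" by (rule J_subset_cut_prime[OF G]) simp
      have sub: "{minor2 i j | i j. i < j \<and> (i, j) \<in> same_component (del_verts G {})}
          \<subseteq> (J G :: ('v xyvar, 'k) mpoly set)"
      proof
        fix q :: "('v xyvar, 'k) mpoly"
        assume "q \<in> {minor2 i j | i j. i < j \<and> (i, j) \<in> same_component (del_verts G {})}"
        then obtain i j where ij: "q = minor2 i j" "i < j" "(i, j) \<in> same_component G"
          unfolding del_verts_empty by blast
        have "{i, j} \<in> edges G"
          by (rule all_simplicial_edge[OF G]) (use True ij in auto)
        then show "q \<in> J G" unfolding ij(1) by (rule minor2_in_J[OF G])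
      qed
      show "cut_prime G {} \<subseteq> (J G :: ('v xyvar, 'k) mpoly set)"
      proof
        fix q :: "('v xyvar, 'k) mpoly" assume "q \<in> cut_prime G {}"
        then obtain a b where q: "q = a + b"
            and a: "a \<in> genideal (graph_ring G) (mvar ` (X ` {} \<union> Y ` {}))"
            and b: "b \<in> genideal (graph_ring G)
              {minor2 i j | i j. i < j \<and> (i, j) \<in> same_component (del_verts G {})}"
          unfolding cut_prime_def set_add_def' by (auto simp: mpoly_ring_simps)
        have "a \<in> J G" using mpoly_genideal_minimal[OF J_ideal[OF G], of "mvar ` (X ` {} \<union> Y ` {})"] a by auto
        moreover have "b \<in> J G" using subsetD[OF mpoly_genideal_minimal[OF J_ideal[OF G] sub] b] .
        ultimately show "q \<in> J G" unfolding q by (rule mpoly_ideal_add[OF J_ideal[OF G]])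
      qed
    qed
    have "cut_param G {} (mvar (X v)) * cut_param G {} p = 0"
      using less.prems(5) unfolding P cut_prime_eq_kernel[OF empty_subsetI]
      by (simp add: cut_param_mult)
    moreover have "cut_param G {} (mvar (X v) :: ('v xyvar, 'k) mpoly) \<noteq> 0"
      by (simp add: cut_param_mvar_eq_0_iff)
    ultimately show ?thesis
      using less.prems(4) unfolding P cut_prime_eq_kernel[OF empty_subsetI] by simp
  next
    case False
    then obtain w i j where w: "w \<in> verts G" "i \<in> nbrs G w" "j \<in> nbrs G w" "i \<noteq> j" "{i, j} \<notin> edges G"
      unfolding simplicial_def by blast
    then have wv: "w \<noteq> v" using less.prems(3) by (auto simp: simplicial_def)
    have ij: "i \<in> verts G" "j \<in> verts G"
      using w simple_graph_edge(2)[OF G] by (auto simp: nbrs_def)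
    let ?H = "complete_nbrs G w" and ?D = "del_verts G {w}"
    have "?N ?H \<subset> ?N G"
      using w ij by auto
    then have H: "card (?N ?H) < card (?N G)" by (rule psubset_card_mono[OF fin])
    have "(w, w) \<in> ?N G" using w(1) simple_graph_edge(3)[OF G, of w w] by auto
    then have "?N ?D \<subset> ?N G" by auto
    then have D: "card (?N ?D) < card (?N G)" by (rule psubset_card_mono[OF fin])
    have "mvar (X v) * p \<in> J ?H" by (rule subsetD[OF J_subset_J_complete[OF G] less.prems(5)])
    then have "p \<in> J ?H"
      using less.prems(2,4) less.hyps[OF H simple_graph_complete[OF G] _
          simplicial_complete_nbrs_other[OF less.prems(3)], of p] by simp
    moreover have "p \<in> vertex_cone G w"
    proof -
      have "kill w (mvar (X v) * p) \<in> J ?D"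
        using subsetD[OF J_subset_vertex_cone[OF G] less.prems(5), of w] by (simp add: vertex_cone_def)
      then have "mvar (X v) * kill w p \<in> J ?D" using wv by (simp add: kill_mult kill_mvar)
      then have "kill w p \<in> J ?D"
        using wv less.prems(2) less.hyps[OF D simple_graph_del[OF G] _
            simplicial_del[OF less.prems(3)] kill_polys[OF less.prems(4)]] by simp
      then show ?thesis using less.prems(4) by (simp add: vertex_cone_def)
    qed
    ultimately show ?thesis by (intro subsetD[OF J_complete_Int_vertex_cone[OF G w(1)]] IntI)
  qed
qed

section \<open>The v-number\<close>

lemma homog_iff: "p \<in> homog A d \<longleftrightarrow> p \<in> polys A \<and> (\<forall>m \<in> Poly_Mapping.keys p. mdeg m = d)"
  by (simp add: homog_def mdeg_def)

lemma homog_mvar_mult: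
  assumes a: "a \<in> A" and p: "p \<in> homog A d"
  shows "mvar a * p \<in> homog A (d + 1)"
  unfolding homog_iff
proof (intro conjI ballI)
  show "mvar a * p \<in> polys A"
    using a p by (intro mpoly_ring_mult_closed) (simp_all add: homog_iff)
  fix m assume "m \<in> Poly_Mapping.keys (mvar a * p)"
  then obtain k where "m = Poly_Mapping.single a 1 + k" "k \<in> Poly_Mapping.keys p"
    using keys_mult[of "mvar a" p] by (auto simp: mvar_def)
  then show "mdeg m = d + 1" using p by (simp add: homog_iff mdeg_add)
qed

lemma homog_kill: "p \<in> homog (xyvars G) d \<Longrightarrow> kill v p \<in> homog (xyvars (del_verts G {v})) d"
  using keys_msubst[of "{X v, Y v}" "\<lambda>m. m" p] kill_polys[of p G v]
  unfolding homog_iff kill_def by auto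

lemma v_number_le:
  assumes "primeideal P (mpoly_ring A)" "f \<in> homog A d" "colon (mpoly_ring A) I f = P"
  shows "v_number A I \<le> enat d"
proof -
  have "P \<in> Ass (mpoly_ring A) I" using assms by (auto simp: Ass_def homog_iff)
  then have "v_number A I \<le> v_at A P I" unfolding v_number_def by (intro Inf_lower) blast
  also have "\<dots> \<le> enat d" unfolding v_at_def using assms by (intro Inf_lower) blast
  finally show ?thesis .
qed

lemma Inf_enat_cases:
  fixes S :: "enat set"
  obtains "Inf S = \<infinity>" | "Inf S \<in> S"
proof (cases "S = {}")
  case True
  then show thesis using that(1) by (simp add: Inf_enat_def)
next
  case False
  then obtain x where "x \<in> S" by blast
  then have "(LEAST x. x \<in> S) \<in> S" by (rule LeastI)
  then show thesis using that(2) False by (simp add: Inf_enat_def)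
qed

lemma v_at_cases:
  obtains "v_at A P I = \<infinity>"
    | d f where "f \<in> homog A d" "colon (mpoly_ring A) I f = P" "v_at A P I = enat d"
proof (cases rule: Inf_enat_cases[of "{enat d | d. \<exists>f \<in> homog A d. colon (mpoly_ring A) I f = P}"])
  case 1
  then show thesis by (intro that(1)) (simp add: v_at_def)
next
  case 2
  then have "\<exists>d. v_at A P I = enat d \<and> (\<exists>f \<in> homog A d. colon (mpoly_ring A) I f = P)"
    unfolding v_at_def by simp
  then show thesis using that(2) by (elim exE conjE bexE)
qed

lemma v_number_cases:
  obtains "v_number A I = \<infinity>"
    | P d f where "primeideal P (mpoly_ring A)" "f \<in> homog A d" "colon (mpoly_ring A) I f = P"
        "v_number A I = enat d"
proof (cases rule: Inf_enat_cases[of "{v_at A P I | P. P \<in> Ass (mpoly_ring A) I}"])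
  case 1
  then show thesis using that(1) unfolding v_number_def by blast
next
  case 2
  then obtain P where P: "P \<in> Ass (mpoly_ring A) I" "v_number A I = v_at A P I"
    unfolding v_number_def by blast
  have prime: "primeideal P (mpoly_ring A)" using P(1) by (simp add: Ass_def)
  show thesis
  proof (cases rule: v_at_cases[of A P I])
    case 1
    then show thesis using P(2) by (intro that(1)) simp
  next
    case (2 d f)
    then show thesis using P(2) by (intro that(2)[OF prime]) simp_all
  qed
qed

lemma colon_mpoly: "colon (mpoly_ring A) I f = {g \<in> polys A. g * f \<in> I}"
  by (simp add: colon_def mpoly_ring_simps(2))

text \<open>If \<open>P = (J : f)\<close> for the ideal \<open>J\<close> of the completed graph, then \<open>P\<close> does not contain the variable \<open>x\<close>
  of the simplicial vertex \<open>v\<close>. As \<open>x * J\<close> lies in the ideal of \<open>G\<close>, which lies in \<open>J\<close>, the product \<open>x * f\<close> has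
  annihilator \<open>P\<close> modulo the ideal of \<open>G\<close>.\<close>

lemma v_J_le_complete_nbrs:
  fixes G :: "'v::linorder ugraph"
  assumes G: "simple_graph G" and v: "v \<in> verts G"
  shows "v_J TYPE('k::field) G \<le> v_J TYPE('k) (complete_nbrs G v) + 1"
proof (cases rule: v_number_cases[of "xyvars G" "J (complete_nbrs G v) :: ('v xyvar, 'k) mpoly set"])
  case 1
  then show ?thesis by (simp add: v_J_def)
next
  case (2 P d f)
  let ?H = "complete_nbrs G v"
  have H: "ideal (J ?H :: ('v xyvar, 'k) mpoly set) (graph_ring G)"
    using J_ideal[OF simple_graph_complete[OF G, of v]] by simp
  have P: "g \<in> P \<longleftrightarrow> g \<in> polys (xyvars G) \<and> g * f \<in> J ?H" for g
    using 2(3) by (auto simp: colon_mpoly)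
  have f: "f \<in> polys (xyvars G)" using 2(2) by (simp add: homog_iff)
  have x: "X v \<in> xyvars G" using v by (simp add: xyvars_def)
  have "mvar (X v) \<notin> P"
  proof
    assume "mvar (X v) \<in> P"
    then have "mvar (X v) * f \<in> J ?H" by (simp add: P)
    then have "f \<in> J ?H"
      using mvar_simplicial_nonzerodivisor[OF simple_graph_complete[OF G, of v] _ simplicial_complete_nbrs[OF G]]
        v f by simp
    then have "P = polys (xyvars G)" using P mpoly_ideal_mult[OF H] by blast
    then show False using primeideal.I_notcarr[OF 2(1)] by simp
  qed
  have "g * (mvar (X v) * f) \<in> J G \<longleftrightarrow> g \<in> P" if g: "g \<in> polys (xyvars G)" for g
  proof
    assume "g * (mvar (X v) * f) \<in> J G"
    then have "g * (mvar (X v) * f) \<in> J ?H" by (rule subsetD[OF J_subset_J_complete[OF G]])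
    then have "g * mvar (X v) \<in> P"
      using g x by (simp add: P mpoly_ring_mult_closed mult.assoc)
    then show "g \<in> P"
      using primeideal.I_prime[OF 2(1) g, of "mvar (X v)"] \<open>mvar (X v) \<notin> P\<close> x
      by (simp add: mpoly_ring_simps(2))
  next
    assume "g \<in> P"
    then have "mvar (X v) * (g * f) \<in> J G"
      by (intro mvar_times_J_complete[OF G v]) (simp_all add: P)
    then show "g * (mvar (X v) * f) \<in> J G" by (simp add: ac_simps)
  qed
  then have "colon (graph_ring G) (J G) (mvar (X v) * f) = P"
    using P by (auto simp: colon_mpoly)
  then have "v_number (xyvars G) (J G :: ('v xyvar, 'k) mpoly set) \<le> enat (d + 1)"
    by (rule v_number_le[OF 2(1) homog_mvar_mult[OF x 2(2)]])
  then show ?thesis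
    using 2(4) by (simp add: v_J_def one_enat_def)
qed

text \<open>The element \<open>f\<close> that realises the cut prime \<open>P\<close> for \<open>G\<close> also does so for the completed graph. If
  \<open>g * f\<close> lies in the larger ideal, multiplying by \<open>x\<close>, the variable of \<open>v\<close>, brings it into the ideal of \<open>G\<close>;
  hence \<open>g * x\<close> is in \<open>P\<close>, which does not contain \<open>x\<close>.\<close>

lemma v_J_complete_nbrs_le:
  fixes G :: "'v::linorder ugraph"
  assumes G: "simple_graph G" and v: "v \<in> verts G" and T: "cutset G T" "v \<notin> T"
    and eq: "v_J TYPE('k::field) G = v_cut TYPE('k) G T"
  shows "v_J TYPE('k) (complete_nbrs G v) \<le> v_J TYPE('k) G"
proof (cases rule: v_at_cases[of "xyvars G" "cut_prime G T" "J G :: ('v xyvar, 'k) mpoly set"])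
  case 1
  then show ?thesis by (simp add: eq v_cut_def)
next
  case (2 d f)
  have TV: "T \<subseteq> verts G" using T by (simp add: cutset_def)
  let ?P = "cut_prime G T :: ('v xyvar, 'k) mpoly set"
  have P: "g \<in> ?P \<longleftrightarrow> g \<in> polys (xyvars G) \<and> g * f \<in> J G" for g
    unfolding 2(2)[symmetric] by (simp add: colon_mpoly)
  have x: "X v \<in> xyvars G" using v by (simp add: xyvars_def)
  have xP: "mvar (X v) \<notin> ?P"
    using T(2) by (auto simp: cut_prime_eq_kernel[OF TV] cut_param_mvar_eq_0_iff)
  have "g * f \<in> J (complete_nbrs G v) \<longleftrightarrow> g \<in> ?P" if g: "g \<in> polys (xyvars G)" for g
  proof
    assume "g * f \<in> J (complete_nbrs G v)"
    then have "mvar (X v) * (g * f) \<in> J G" by (intro mvar_times_J_complete[OF G v]) simp_all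
    then have "g * mvar (X v) \<in> ?P"
      using g x by (simp add: P mpoly_ring_mult_closed ac_simps)
    then show "g \<in> ?P"
      using primeideal.I_prime[OF cut_prime_prime[OF TV] g, of "mvar (X v)"] xP x
      by (simp add: mpoly_ring_simps(2))
  next
    assume "g \<in> ?P"
    then show "g * f \<in> J (complete_nbrs G v)"
      by (intro subsetD[OF J_subset_J_complete[OF G]]) (simp add: P)
  qed
  then have "colon (graph_ring G) (J (complete_nbrs G v)) f = ?P"
    using P by (auto simp: colon_mpoly)
  then have "v_number (xyvars G) (J (complete_nbrs G v) :: ('v xyvar, 'k) mpoly set) \<le> enat d"
    by (rule v_number_le[OF cut_prime_prime[OF TV] 2(1)])
  then show ?thesis
    using 2(3) by (simp add: eq v_cut_def) (simp add: v_J_def)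
qed

text \<open>Two neighbours \<open>i\<close> and \<open>j\<close> of \<open>v\<close> in different components of \<open>G - T\<close> give an element of the ideal of the
  completed graph outside the cut prime \<open>P\<close>. Since it multiplies the cone into the ideal of \<open>G\<close>, the
  element \<open>f\<close> realising \<open>P\<close> for \<open>G\<close> also realises it for the cone, and the retraction of \<open>f\<close> realises
  the contraction of \<open>P\<close> for \<open>G - v\<close>.\<close>

lemma v_J_del_le:
  fixes G :: "'v::linorder ugraph"
  assumes G: "simple_graph G" and T: "cutset G T" "v \<in> T"
    and eq: "v_J TYPE('k::field) G = v_cut TYPE('k) G T"
  shows "v_J TYPE('k) (del_verts G {v}) \<le> v_J TYPE('k) G"
proof (cases rule: v_at_cases[of "xyvars G" "cut_prime G T" "J G :: ('v xyvar, 'k) mpoly set"])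
  case 1
  then show ?thesis by (simp add: eq v_cut_def)
next
  case (2 d f)
  have TV: "T \<subseteq> verts G" using T by (simp add: cutset_def)
  then have v: "v \<in> verts G" using T(2) by blast
  let ?D = "del_verts G {v}"
  let ?P = "cut_prime G T :: ('v xyvar, 'k) mpoly set"
  let ?P' = "{g \<in> polys (xyvars ?D). cut_param G T g = 0} :: ('v xyvar, 'k) mpoly set"
  have P: "g \<in> ?P \<longleftrightarrow> g \<in> polys (xyvars G) \<and> g * f \<in> J G" for g
    unfolding 2(2)[symmetric] by (simp add: colon_mpoly)
  have f: "f \<in> polys (xyvars G)" using 2(1) by (simp add: homog_iff)
  obtain i j where ij: "i \<in> nbrs G v - T" "j \<in> nbrs G v - T"
      "(i, j) \<notin> same_component (del_verts G T)"
    using cutset_separates_nbrs[OF G T] .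
  then have V: "i \<in> verts G" "j \<in> verts G"
    using simple_graph_edge(2)[OF G] by (auto simp: nbrs_def)
  have ne: "i \<noteq> j" using ij V by (auto simp: same_component_def)
  have m: "(minor2 i j :: ('v xyvar, 'k) mpoly) \<notin> ?P"
    using ij by (simp add: cut_prime_eq_kernel[OF TV] cut_param_minor2_eq_0_iff[OF V])
  have mH: "(minor2 i j :: ('v xyvar, 'k) mpoly) \<in> J (complete_nbrs G v)"
    using ij ne by (intro minor2_in_J simple_graph_complete G) simp
  have "g * kill v f \<in> J ?D \<longleftrightarrow> g \<in> ?P'" if g: "g \<in> polys (xyvars ?D)" for g
  proof -
    have gG: "g \<in> polys (xyvars G)" by (rule polys_del[OF g])
    have "g * kill v f \<in> J ?D \<longleftrightarrow> g * f \<in> vertex_cone G v"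
      using mpoly_ring_mult_closed[OF gG f] by (simp add: vertex_cone_def kill_mult kill_id[OF g])
    also have "\<dots> \<longleftrightarrow> g \<in> ?P"
    proof
      assume "g * f \<in> vertex_cone G v"
      then have "g * f * minor2 i j \<in> J G" using mH by (rule vertex_cone_times_J_complete[OF G v])
      then have "g * minor2 i j \<in> ?P"
        using mpoly_ring_mult_closed[OF gG minor2_graph_ring[OF V]] by (simp add: P ac_simps)
      then show "g \<in> ?P"
        using primeideal.I_prime[OF cut_prime_prime[OF TV] gG minor2_graph_ring[OF V]] m
        by (simp add: mpoly_ring_simps(2))
    next
      assume "g \<in> ?P"
      then show "g * f \<in> vertex_cone G v"
        by (intro subsetD[OF J_subset_vertex_cone[OF G]]) (simp add: P)
    qed
    also have "\<dots> \<longleftrightarrow> g \<in> ?P'"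
      using g gG by (simp add: cut_prime_eq_kernel[OF TV])
    finally show ?thesis .
  qed
  then have colon: "colon (graph_ring ?D) (J ?D) (kill v f) = ?P'"
    by (auto simp: colon_mpoly)
  have prime: "primeideal ?P' (graph_ring ?D)"
    unfolding cut_param_def by (rule primeideal_msubst_kernel) (rule toric_exp_add)
  have "v_number (xyvars ?D) (J ?D :: ('v xyvar, 'k) mpoly set) \<le> enat d"
    by (rule v_number_le[OF prime homog_kill[OF 2(1)] colon])
  then show ?thesis
    using 2(3) by (simp add: eq v_cut_def) (simp add: v_J_def)
qed

theorem proposition3p3:
  fixes G :: "'v::linorder ugraph"
  assumes "simple_graph G"
  shows "(\<forall>v \<in> verts G. v_J TYPE('k::field) G \<le> v_J TYPE('k) (complete_nbrs G v) + 1) \<and>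
    (\<forall>v \<in> verts G.
      (\<exists>T. cutset G T \<and> v \<notin> T \<and> v_J TYPE('k) G = v_cut TYPE('k) G T) \<longrightarrow>
      v_J TYPE('k) (complete_nbrs G v) \<le> v_J TYPE('k) G) \<and>
    (\<forall>v \<in> verts G.
      (\<exists>T. cutset G T \<and> v \<in> T \<and> v_J TYPE('k) G = v_cut TYPE('k) G T) \<longrightarrow>
      v_J TYPE('k) (del_verts G {v}) \<le> v_J TYPE('k) G)"
proof (intro conjI ballI impI)
  fix v assume v: "v \<in> verts G"
  show "v_J TYPE('k) G \<le> v_J TYPE('k) (complete_nbrs G v) + 1"
    by (rule v_J_le_complete_nbrs[OF assms v])
  show "v_J TYPE('k) (complete_nbrs G v) \<le> v_J TYPE('k) G"
    if "\<exists>T. cutset G T \<and> v \<notin> T \<and> v_J TYPE('k) G = v_cut TYPE('k) G T"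
    using that v_J_complete_nbrs_le[OF assms v] by blast
  show "v_J TYPE('k) (del_verts G {v}) \<le> v_J TYPE('k) G"
    if "\<exists>T. cutset G T \<and> v \<in> T \<and> v_J TYPE('k) G = v_cut TYPE('k) G T"
    using that v_J_del_le[OF assms] by blast
qed

end
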